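(* The space of exotic forests $\mathcal{EF}$, together with the Grossman–Larson product $\diamond$ and the deshuffle coproduct $\Delta_{\sqcup\!\sqcup}$, forms a Hopf algebra.
   Context: Exotic forests. A planar forest is an ordered, possibly empty, sequence of planar rooted trees (children ordered left to right); $\mathbf 1$ is the empty forest (the unit). An exotic forest is a planar forest whose nodes are each decorated by $\bullet$ or by a positive integer, such that integers only decorate leaves (nodes without children; a one-node tree's root is a leaf) and every integer used decorates exactly two leaves (such a pair is a liana). Exotic forests differing by a renumbering of the integers are identified. $EF$ is the set of exotic forests, $\mathcal{EF}$ its linear span, graded by $|\pi|=\#\{\text{black nodes}\}+\frac12\#\{\text{numbered nodes}\}$. In products, the integers of the two factors are chosen disjoint. Grossman–Larson product $\diamond$: $\pi\diamond\eta$ is the sum over all maps sending each root of $\pi$ either to "stay" or to a black node of $\eta$: trees of $\pi$ that stay are concatenated, in order, to the left of $\eta$; trees sent to a black node $v$ of $\eta$ are attached, in order, as new children of $v$ to the left of the existing ones. Deshuffle coproduct: call $\pi\in EF\setminus\{\mathbf 1\}$ connected if the sequence of its trees cannot be split into two non-empty complementary subsequences each of which is an exotic forest (i.e. with no liana joining the two). Every $\pi$ decomposes uniquely into connected components (subsequences of trees), and $\Delta_{\sqcup\!\sqcup}(\pi)=\sum_S\pi_S\otimes\pi_{S^c}$, the sum over all subsets $S$ of the set of connected components of $\pi$, where $\pi_S$ is the exotic forest formed by the trees in components of $S$ in their original order. *)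

theory Defs
  imports Complex_Main "HOL-Library.Poly_Mapping" "HOL-Library.FuncSet" "HOL-Library.Disjoint_Sets"
begin

section \<open>Hopf algebras on free modules\<close>

text \<open>The vector space with basis \<open>'b\<close> over the field \<open>'k\<close> is the type
  \<open>'b \<Rightarrow>\<^sub>0 'k\<close> of finitely supported functions. The tensor product of the
  spaces with bases \<open>'b\<close> and \<open>'c\<close> is identified with the space with basis \<open>'b \<times> 'c\<close>, the pure
  tensor of two basis vectors being the pair. Every vector space has a basis, so the
  notion of Hopf algebra below is the general one.\<close>

definition scale :: "'k::field \<Rightarrow> ('b \<Rightarrow>\<^sub>0 'k) \<Rightarrow> ('b \<Rightarrow>\<^sub>0 'k)" where
  "scale c p = Poly_Mapping.map ((*) c) p"

lemma lookup_scale: "Poly_Mapping.lookup (scale c p) b = c * Poly_Mapping.lookup p b"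
  by (simp add: scale_def Poly_Mapping.map.rep_eq when_def)

lemma vector_space_scale: "vector_space (scale :: 'k::field \<Rightarrow> ('b \<Rightarrow>\<^sub>0 'k) \<Rightarrow> _)"
  unfolding vector_space_def
  by (auto intro!: poly_mapping_eqI simp: lookup_scale lookup_add algebra_simps)

definition basis :: "'b \<Rightarrow> ('b \<Rightarrow>\<^sub>0 'k::field)" where
  "basis b = Poly_Mapping.single b 1"

definition lin_ext :: "('b \<Rightarrow> ('c \<Rightarrow>\<^sub>0 'k)) \<Rightarrow> ('b \<Rightarrow>\<^sub>0 'k::field) \<Rightarrow> ('c \<Rightarrow>\<^sub>0 'k)" where
  "lin_ext f p = (\<Sum>b\<in>Poly_Mapping.keys p. scale (Poly_Mapping.lookup p b) (f b))"

definition bilin_ext ::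
  "('a \<Rightarrow> 'b \<Rightarrow> ('c \<Rightarrow>\<^sub>0 'k)) \<Rightarrow> ('a \<Rightarrow>\<^sub>0 'k::field) \<Rightarrow> ('b \<Rightarrow>\<^sub>0 'k) \<Rightarrow> ('c \<Rightarrow>\<^sub>0 'k)" where
  "bilin_ext f p q = lin_ext (\<lambda>a. lin_ext (f a) q) p"

definition tensor :: "('a \<Rightarrow>\<^sub>0 'k::field) \<Rightarrow> ('b \<Rightarrow>\<^sub>0 'k) \<Rightarrow> ('a \<times> 'b \<Rightarrow>\<^sub>0 'k)" where
  "tensor = bilin_ext (\<lambda>a b. basis (a, b))"

definition tensor_map ::
  "(('a \<Rightarrow>\<^sub>0 'k::field) \<Rightarrow> ('c \<Rightarrow>\<^sub>0 'k)) \<Rightarrow> (('b \<Rightarrow>\<^sub>0 'k) \<Rightarrow> ('d \<Rightarrow>\<^sub>0 'k))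
    \<Rightarrow> ('a \<times> 'b \<Rightarrow>\<^sub>0 'k) \<Rightarrow> ('c \<times> 'd \<Rightarrow>\<^sub>0 'k)" where
  "tensor_map f g = lin_ext (\<lambda>(a, b). tensor (f (basis a)) (g (basis b)))"

definition tensor_assoc :: "(('a \<times> 'b) \<times> 'c \<Rightarrow>\<^sub>0 'k::field) \<Rightarrow> ('a \<times> 'b \<times> 'c \<Rightarrow>\<^sub>0 'k)" where
  "tensor_assoc = lin_ext (\<lambda>((a, b), c). basis (a, b, c))"

text \<open>A bilinear product as a linear map on the tensor square, and the induced product on the
  tensor square.\<close>

definition mult_map ::
  "(('b \<Rightarrow>\<^sub>0 'k::field) \<Rightarrow> ('b \<Rightarrow>\<^sub>0 'k) \<Rightarrow> ('b \<Rightarrow>\<^sub>0 'k)) \<Rightarrow> ('b \<times> 'b \<Rightarrow>\<^sub>0 'k) \<Rightarrow> ('b \<Rightarrow>\<^sub>0 'k)" where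
  "mult_map m = lin_ext (\<lambda>(a, b). m (basis a) (basis b))"

definition tensor_mult ::
  "(('b \<Rightarrow>\<^sub>0 'k::field) \<Rightarrow> ('b \<Rightarrow>\<^sub>0 'k) \<Rightarrow> ('b \<Rightarrow>\<^sub>0 'k))
    \<Rightarrow> ('b \<times> 'b \<Rightarrow>\<^sub>0 'k) \<Rightarrow> ('b \<times> 'b \<Rightarrow>\<^sub>0 'k) \<Rightarrow> ('b \<times> 'b \<Rightarrow>\<^sub>0 'k)" where
  "tensor_mult m = bilin_ext (\<lambda>(a, b) (c, d).
     tensor (m (basis a) (basis c)) (m (basis b) (basis d)))"

locale unital_algebra =
  fixes mult :: "('b \<Rightarrow>\<^sub>0 'k::field) \<Rightarrow> ('b \<Rightarrow>\<^sub>0 'k) \<Rightarrow> ('b \<Rightarrow>\<^sub>0 'k)"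
    and unit :: "'b \<Rightarrow>\<^sub>0 'k"
  assumes linear_mult_left: "Vector_Spaces.linear scale scale (\<lambda>x. mult x y)"
    and linear_mult_right: "Vector_Spaces.linear scale scale (mult x)"
    and mult_assoc: "mult (mult x y) z = mult x (mult y z)"
    and mult_unit_left: "mult unit x = x"
    and mult_unit_right: "mult x unit = x"

locale counital_coalgebra =
  fixes comult :: "('b \<Rightarrow>\<^sub>0 'k::field) \<Rightarrow> ('b \<times> 'b \<Rightarrow>\<^sub>0 'k)"
    and counit :: "('b \<Rightarrow>\<^sub>0 'k) \<Rightarrow> 'k"
  assumes linear_comult: "Vector_Spaces.linear scale scale comult"
    and linear_counit: "Vector_Spaces.linear scale (*) counit"
    and coassoc: "tensor_assoc (tensor_map comult id (comult x)) = tensor_map id comult (comult x)"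
    and counit_left: "lin_ext (\<lambda>(a, b). scale (counit (basis a)) (basis b)) (comult x) = x"
    and counit_right: "lin_ext (\<lambda>(a, b). scale (counit (basis b)) (basis a)) (comult x) = x"

locale bialgebra =
  unital_algebra mult unit + counital_coalgebra comult counit
  for mult :: "('b \<Rightarrow>\<^sub>0 'k::field) \<Rightarrow> ('b \<Rightarrow>\<^sub>0 'k) \<Rightarrow> ('b \<Rightarrow>\<^sub>0 'k)"
    and unit :: "'b \<Rightarrow>\<^sub>0 'k"
    and comult :: "('b \<Rightarrow>\<^sub>0 'k) \<Rightarrow> ('b \<times> 'b \<Rightarrow>\<^sub>0 'k)"
    and counit :: "('b \<Rightarrow>\<^sub>0 'k) \<Rightarrow> 'k" +
  assumes comult_mult: "comult (mult x y) = tensor_mult mult (comult x) (comult y)"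
    and comult_unit: "comult unit = tensor unit unit"
    and counit_mult: "counit (mult x y) = counit x * counit y"
    and counit_unit: "counit unit = 1"

locale hopf_algebra =
  bialgebra mult unit comult counit
  for mult :: "('b \<Rightarrow>\<^sub>0 'k::field) \<Rightarrow> ('b \<Rightarrow>\<^sub>0 'k) \<Rightarrow> ('b \<Rightarrow>\<^sub>0 'k)"
    and unit :: "'b \<Rightarrow>\<^sub>0 'k"
    and comult :: "('b \<Rightarrow>\<^sub>0 'k) \<Rightarrow> ('b \<times> 'b \<Rightarrow>\<^sub>0 'k)"
    and counit :: "('b \<Rightarrow>\<^sub>0 'k) \<Rightarrow> 'k"
    and antipode :: "('b \<Rightarrow>\<^sub>0 'k) \<Rightarrow> ('b \<Rightarrow>\<^sub>0 'k)" +
  assumes linear_antipode: "Vector_Spaces.linear scale scale antipode"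
    and antipode_left: "mult_map mult (tensor_map antipode id (comult x)) = scale (counit x) unit"
    and antipode_right: "mult_map mult (tensor_map id antipode (comult x)) = scale (counit x) unit"


section \<open>Exotic forests\<close>

text \<open>Only leaves can carry a number, so numbered nodes are a constructor without children;
  a black leaf is \<open>Black []\<close>.\<close>

datatype 'a tree = Black "'a tree list" | Num 'a

type_synonym 'a forest = "'a tree list"

primrec tree_labels :: "'a tree \<Rightarrow> 'a list" where
  "tree_labels (Black ts) = concat (map tree_labels ts)"
| "tree_labels (Num a) = [a]"

definition labels :: "'a forest \<Rightarrow> 'a list" where
  "labels F = concat (map tree_labels F)"

definition relabel :: "('a \<Rightarrow> 'b) \<Rightarrow> 'a forest \<Rightarrow> 'b forest" where
  "relabel f F = map (map_tree f) F"

definition exotic :: "nat forest \<Rightarrow> bool" where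
  "exotic F \<longleftrightarrow> (\<forall>n\<in>set (labels F). n > 0 \<and> count_list (labels F) n = 2)"

definition renumbering :: "nat forest \<Rightarrow> nat forest \<Rightarrow> bool" where
  "renumbering F G \<longleftrightarrow> exotic F \<and> exotic G \<and>
     (\<exists>f. inj_on f (set (labels F)) \<and> G = relabel f F)"

lemma set_tree_labels: "set (tree_labels t) = set_tree t"
  by (induction t) auto

lemma set_labels_relabel: "set (labels (relabel f F)) = f ` set (labels F)"
  by (auto simp: labels_def relabel_def set_tree_labels tree.set_map)

lemma relabel_relabel: "relabel g (relabel f F) = relabel (g \<circ> f) F"
  by (simp add: relabel_def tree.map_comp)

lemma relabel_cong_id:
  assumes "\<And>n. n \<in> set (labels F) \<Longrightarrow> f n = n"
  shows "relabel f F = F"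
proof -
  have "map_tree f t = t" if "t \<in> set F" for t
  proof -
    have "map_tree f t = map_tree (\<lambda>x. x) t"
      using assms that by (intro tree.map_cong refl) (auto simp: labels_def set_tree_labels)
    then show ?thesis by (simp add: tree.map_ident)
  qed
  then show ?thesis by (simp add: relabel_def map_idI)
qed

quotient_type exotic_forest = "nat forest" / partial: renumbering
proof (rule part_equivpI)
  have "renumbering [] []" by (simp add: renumbering_def exotic_def labels_def relabel_def)
  then show "\<exists>F. renumbering F F" by blast
  show "symp renumbering"
  proof (rule sympI)
    fix F G assume "renumbering F G"
    then obtain f where f: "exotic F" "exotic G" "inj_on f (set (labels F))" "G = relabel f F"
      by (auto simp: renumbering_def)
    let ?g = "inv_into (set (labels F)) f"
    have "relabel ?g G = F"
      unfolding f(4) relabel_relabel by (rule relabel_cong_id) (simp add: f(3))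
    moreover have "inj_on ?g (set (labels G))"
      unfolding f(4) set_labels_relabel by (rule inj_on_inv_into) simp
    ultimately show "renumbering G F" using f by (auto simp: renumbering_def)
  qed
  show "transp renumbering"
  proof (rule transpI)
    fix F G H assume "renumbering F G" "renumbering G H"
    then obtain f g where "exotic F" "exotic H" "inj_on f (set (labels F))" "G = relabel f F"
      "inj_on g (set (labels G))" "H = relabel g G"
      unfolding renumbering_def by blast
    moreover from this have "inj_on (g \<circ> f) (set (labels F))"
      by (simp add: set_labels_relabel comp_inj_on)
    ultimately show "renumbering F H"
      unfolding renumbering_def relabel_relabel by (metis relabel_relabel)
  qed
qed

definition empty_forest :: exotic_forest where
  "empty_forest = abs_exotic_forest []"


section \<open>The Grossman--Larson product\<close>

text \<open>A node of a forest is addressed by its path: the position of its tree in the forest,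
  followed by the successive positions among siblings. The first argument of
  \<open>black_forest\<close> and \<open>attach_forest\<close> is the position of the first tree of the list.\<close>

primrec black_tree :: "'a tree \<Rightarrow> nat list set"
    and black_forest :: "'a forest \<Rightarrow> nat \<Rightarrow> nat list set" where
  "black_tree (Black ts) = insert [] (black_forest ts 0)"
| "black_tree (Num a) = {}"
| "black_forest [] i = {}"
| "black_forest (t # ts) i = (#) i ` black_tree t \<union> black_forest ts (Suc i)"

text \<open>Attach, at each black node \<open>v\<close>, the trees \<open>g v\<close> to the left of the existing children.\<close>

primrec attach_tree :: "'a tree \<Rightarrow> (nat list \<Rightarrow> 'a forest) \<Rightarrow> 'a tree"
    and attach_forest :: "'a forest \<Rightarrow> nat \<Rightarrow> (nat list \<Rightarrow> 'a forest) \<Rightarrow> 'a forest" where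
  "attach_tree (Black ts) g = Black (g [] @ attach_forest ts 0 g)"
| "attach_tree (Num a) g = Num a"
| "attach_forest [] i g = []"
| "attach_forest (t # ts) i g = attach_tree t (\<lambda>v. g (i # v)) # attach_forest ts (Suc i) g"

text \<open>The target \<open>None\<close> means ``stay''.\<close>

definition targets :: "'a forest \<Rightarrow> nat list option set" where
  "targets G = insert None (Some ` black_forest G 0)"

definition graft :: "'a forest \<Rightarrow> 'a forest \<Rightarrow> (nat \<Rightarrow> nat list option) \<Rightarrow> 'a forest" where
  "graft F G \<phi> =
     (let sent = \<lambda>v. nths F {i. \<phi> i = v}
      in sent None @ attach_forest G 0 (\<lambda>v. sent (Some v)))"

text \<open>Representatives with disjoint integers are obtained by making the numbers of the left
  factor odd and those of the right factor even.\<close>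

definition gl_basis :: "exotic_forest \<Rightarrow> exotic_forest \<Rightarrow> (exotic_forest \<Rightarrow>\<^sub>0 'k::field)" where
  "gl_basis \<pi> \<eta> =
     (let F = relabel (\<lambda>n. 2 * n + 1) (rep_exotic_forest \<pi>);
          G = relabel (\<lambda>n. 2 * n) (rep_exotic_forest \<eta>)
      in \<Sum>\<phi> \<in> {..<length F} \<rightarrow>\<^sub>E targets G. basis (abs_exotic_forest (graft F G \<phi>)))"

definition gl_product ::
  "(exotic_forest \<Rightarrow>\<^sub>0 'k::field) \<Rightarrow> (exotic_forest \<Rightarrow>\<^sub>0 'k) \<Rightarrow> (exotic_forest \<Rightarrow>\<^sub>0 'k)" where
  "gl_product = bilin_ext gl_basis"


section \<open>The deshuffle coproduct\<close>

text \<open>Subsequences of \<open>F\<close> are given by their sets of positions; \<open>connected_in F C\<close> says that the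
  subsequence at the positions \<open>C\<close> is a connected exotic forest.\<close>

definition connected_in :: "nat forest \<Rightarrow> nat set \<Rightarrow> bool" where
  "connected_in F C \<longleftrightarrow> C \<subseteq> {..<length F} \<and> C \<noteq> {} \<and> exotic (nths F C) \<and>
     \<not> (\<exists>D. D \<noteq> {} \<and> D \<subset> C \<and> exotic (nths F D) \<and> exotic (nths F (C - D)))"

text \<open>The components are the unique decomposition of an exotic forest into connected exotic
  forests: see \<open>partition_on_components\<close> and \<open>components_unique\<close> below.\<close>

definition components :: "nat forest \<Rightarrow> nat set set" where
  "components F = {C. connected_in F C}"

lemma labels_count_nths:
  assumes "I \<subseteq> {..<length F}"
  shows "count_list (labels (nths F I)) n = (\<Sum>i\<in>I. count_list (tree_labels (F ! i)) n)"
  using assms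
proof (induction F arbitrary: I rule: rev_induct)
  case Nil
  then show ?case by (simp add: labels_def)
next
  case (snoc t F)
  let ?J = "I - {length F}"
  have J: "?J \<subseteq> {..<length F}" using snoc.prems by (auto simp: less_Suc_eq)
  have fin: "finite I" using snoc.prems finite_subset by blast
  have eq: "(\<Sum>i\<in>?J. count_list (tree_labels ((F @ [t]) ! i)) n)
      = (\<Sum>i\<in>?J. count_list (tree_labels (F ! i)) n)"
    using J by (intro sum.cong) (auto simp: nth_append)
  have nn: "nths F I = nths F ?J"
    unfolding nths_def by (intro arg_cong[of _ _ "map fst"] filter_cong) (auto dest: set_zip_rightD)
  show ?case
  proof (cases "length F \<in> I")
    case True
    then show ?thesis
      using snoc.IH[OF J] eq fin
      by (simp add: nths_append nn labels_def sum.remove)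
  next
    case False
    then have "?J = I" by auto
    then show ?thesis
      using False snoc.IH[OF J] eq by (simp add: nths_append labels_def)
  qed
qed

lemma exotic_nths_iff:
  assumes F: "exotic F" and I: "I \<subseteq> {..<length F}"
  shows "exotic (nths F I) \<longleftrightarrow>
    (\<forall>n. (\<forall>i\<in>I. n \<notin> set (tree_labels (F ! i))) \<or> 
         (\<forall>i\<in>{..<length F} - I. n \<notin> set (tree_labels (F ! i))))"
proof -
  let ?k = "\<lambda>i n. count_list (tree_labels (F ! i)) n"
  have fin: "finite I" using I finite_subset by blast
  have k0: "?k i n = 0 \<longleftrightarrow> n \<notin> set (tree_labels (F ! i))" for i n
    by (simp add: count_list_0_iff)
  have all: "count_list (labels F) n = (\<Sum>i<length F. ?k i n)" for n
    using labels_count_nths[of "{..<length F}" F n] by (simp add: nths_all)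
  have split: "count_list (labels F) n
      = count_list (labels (nths F I)) n + (\<Sum>i\<in>{..<length F} - I. ?k i n)" for n
    unfolding all labels_count_nths[OF I] using sum.subset_diff[OF I, of "\<lambda>i. ?k i n"] by simp
  have z1: "n \<notin> set (labels (nths F I)) \<longleftrightarrow> (\<forall>i\<in>I. n \<notin> set (tree_labels (F ! i)))" for n
    unfolding count_list_0_iff[symmetric] labels_count_nths[OF I] using fin by simp
  have z2: "(\<Sum>i\<in>{..<length F} - I. ?k i n) = 0
      \<longleftrightarrow> (\<forall>i\<in>{..<length F} - I. n \<notin> set (tree_labels (F ! i)))" for n
    by (simp add: count_list_0_iff)
  have "n \<in> set (labels (nths F I)) \<Longrightarrow> n > 0 \<and> count_list (labels F) n = 2" for n
    using F set_nths_subset[of F I] by (auto simp: exotic_def labels_def)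
  then have "exotic (nths F I) \<longleftrightarrow>
     (\<forall>n. n \<notin> set (labels (nths F I)) \<or> (\<Sum>i\<in>{..<length F} - I. ?k i n) = 0)"
    unfolding exotic_def using split by fastforce
  then show ?thesis unfolding z1 z2 .
qed

lemma exotic_nths_diff:
  assumes "exotic F" "I \<subseteq> {..<length F}" "J \<subseteq> {..<length F}"
    "exotic (nths F I)" "exotic (nths F J)"
  shows "exotic (nths F (I - J))"
proof -
  have "I - J \<subseteq> {..<length F}" using assms(2) by auto
  then show ?thesis
    using assms(4,5)
    unfolding exotic_nths_iff[OF assms(1,2)] exotic_nths_iff[OF assms(1,3)]
      exotic_nths_iff[OF assms(1) \<open>I - J \<subseteq> _\<close>] by blast
qed

lemma exotic_contains_connected:
  assumes "exotic F" "I \<subseteq> {..<length F}" "exotic (nths F I)" "x \<in> I"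
  shows "\<exists>C. connected_in F C \<and> C \<subseteq> I \<and> x \<in> C"
  using assms(2-)
proof (induction "card I" arbitrary: I rule: less_induct)
  case less
  have fin: "finite I" using less.prems finite_subset by blast
  show ?case
  proof (cases "connected_in F I")
    case True
    then show ?thesis using less.prems by blast
  next
    case False
    then obtain D where D: "D \<noteq> {}" "D \<subset> I" "exotic (nths F D)" "exotic (nths F (I - D))"
      using less.prems unfolding connected_in_def by blast
    define E where "E = (if x \<in> D then D else I - D)"
    have E: "E \<subset> I" "exotic (nths F E)" "x \<in> E"
      using D less.prems by (auto simp: E_def)
    then obtain C where "connected_in F C" "C \<subseteq> E" "x \<in> C"
      using less.hyps[of E] less.prems psubset_card_mono[OF fin] by blast
    then show ?thesis using E by blast
  qed
qed

lemma connected_in_disjoint: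
  assumes "exotic F" "connected_in F C" "connected_in F C'" "x \<in> C" "x \<in> C'"
  shows "C = C'"
proof -
  have sub: "A \<subseteq> B" if A: "connected_in F A" "x \<in> A" and B: "connected_in F B" "x \<in> B" for A B
  proof (rule ccontr)
    assume "\<not> A \<subseteq> B"
    have AB: "A \<subseteq> {..<length F}" "B \<subseteq> {..<length F}" "exotic (nths F A)" "exotic (nths F B)"
      using A B by (auto simp: connected_in_def)
    have *: "exotic (nths F (A - B))"
      by (rule exotic_nths_diff[OF assms(1) AB])
    have "A - B \<subseteq> {..<length F}" using AB by blast
    then have "exotic (nths F (A - (A - B)))"
      by (rule exotic_nths_diff[OF assms(1) AB(1) _ AB(3) *])
    moreover have "A - B \<noteq> {}" "A - B \<subset> A" using A B \<open>\<not> A \<subseteq> B\<close> by auto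
    ultimately show False
      using A * unfolding connected_in_def by metis
  qed
  show ?thesis using sub assms by blast
qed

lemma partition_on_components:
  assumes "exotic F"
  shows "partition_on {..<length F} (components F)"
proof (rule partition_onI)
  have "exotic (nths F {..<length F})" using assms by (simp add: nths_all)
  then show "\<Union> (components F) = {..<length F}"
    using exotic_contains_connected[OF assms order_refl]
    by (fastforce simp: components_def connected_in_def)
  show "disjnt C C'" if "C \<in> components F" "C' \<in> components F" "C \<noteq> C'" for C C'
    using that connected_in_disjoint[OF assms] by (auto simp: components_def disjnt_iff)
qed (auto simp: components_def connected_in_def)

lemma components_unique:
  assumes "exotic F" "partition_on {..<length F} P" "\<forall>C\<in>P. connected_in F C"
  shows "P = components F"
proof
  show "P \<subseteq> components F" using assms(3) by (auto simp: components_def)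
  show "components F \<subseteq> P"
  proof
    fix C assume C: "C \<in> components F"
    then obtain x where x: "x \<in> C" "x < length F"
      by (auto simp: components_def connected_in_def)
    then obtain D where "D \<in> P" "x \<in> D"
      using partition_onD1[OF assms(2)] by blast
    then show "C \<in> P"
      using connected_in_disjoint[OF assms(1), of C D x] C x assms(3)
      by (auto simp: components_def)
  qed
qed

definition deshuffle_basis ::
  "exotic_forest \<Rightarrow> (exotic_forest \<times> exotic_forest \<Rightarrow>\<^sub>0 'k::field)" where
  "deshuffle_basis \<pi> =
     (let F = rep_exotic_forest \<pi>
      in \<Sum>S \<in> Pow (components F).
           basis (abs_exotic_forest (nths F (\<Union>S)),
                  abs_exotic_forest (nths F (\<Union>(components F - S)))))"

definition deshuffle ::
  "(exotic_forest \<Rightarrow>\<^sub>0 'k::field) \<Rightarrow> (exotic_forest \<times> exotic_forest \<Rightarrow>\<^sub>0 'k)" where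
  "deshuffle = lin_ext deshuffle_basis"

end

theory Submission
  imports Defs "HOL-Library.Multiset"
begin

text \<open>Following Guin and Oudom, the product is \<open>F \<diamond> G = \<Sum> F\<^sub>1 \<cdot> (F\<^sub>2 \<rhd> G)\<close>, summed over the ways to
  unshuffle the trees of \<open>F\<close> into those that stay and those that are grafted onto \<open>G\<close>, and
  grafting obeys \<open>F \<rhd> (G \<cdot> H) = \<Sum> (F\<^sub>1 \<rhd> G) \<cdot> (F\<^sub>2 \<rhd> H)\<close>. Coassociativity and cocommutativity of
  unshuffling make \<open>\<rhd>\<close>, hence \<open>\<diamond>\<close>, compatible with it, and associativity \<open>F \<rhd> (G \<rhd> K) = (F \<diamond> G) \<rhd> K\<close>
  follows by structural induction on \<open>K\<close>. All this holds for forests with arbitrary labels. A union of components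
  of an exotic forest is a subsequence that is itself exotic, so the deshuffle coproduct is unshuffling
  followed by discarding the non-exotic parts. The labels of a term of \<open>F \<diamond> G\<close> are those of \<open>F\<close> and
  \<open>G\<close>; when these are disjoint, the term is exotic exactly if \<open>F\<close> and \<open>G\<close> are, so the identities descend
  to exotic forests. The antipode exists because the coproduct is conilpotent with respect to the number
  of trees.\<close>


section \<open>Unshuffling\<close>

text \<open>Formal sums of forests are represented by the functional that sends \<open>f\<close> to the sum of the values of
  \<open>f\<close> on the terms; this makes bilinear identities provable by rewriting, without any module
  structure. Here the terms are the pairs of complementary subsequences.\<close>

primrec unshuffle :: "'a list \<Rightarrow> ('a list \<Rightarrow> 'a list \<Rightarrow> 'm::comm_monoid_add) \<Rightarrow> 'm" where
  "unshuffle [] f = f [] []"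
| "unshuffle (x # xs) f = unshuffle xs (\<lambda>A B. f (x # A) B) + unshuffle xs (\<lambda>A B. f A (x # B))"

lemma unshuffle_add: "unshuffle F (\<lambda>A B. f A B + g A B) = unshuffle F f + unshuffle F g"
  by (induction F arbitrary: f g) (simp_all add: algebra_simps)

lemma unshuffle_0 [simp]: "unshuffle F (\<lambda>A B. 0) = 0"
  by (induction F) simp_all

lemma unshuffle_hom:
  assumes "\<And>x y. L (x + y) = L x + L y"
  shows "L (unshuffle F f) = unshuffle F (\<lambda>A B. L (f A B))"
  by (induction F arbitrary: f) (simp_all add: assms)

text \<open>All that is recorded about the two parts is the union of their multisets. It fixes their
  combined labels and their total length, and nothing more is tracked later.\<close>

lemma unshuffle_closed:
  assumes add: "\<And>x y. P x \<Longrightarrow> P y \<Longrightarrow> P (x + y)"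
    and "\<And>A B. mset A + mset B = mset F \<Longrightarrow> P (f A B)"
  shows "P (unshuffle F f)"
  using assms(2)
proof (induction F arbitrary: f)
  case (Cons x F)
  show ?case
    unfolding unshuffle.simps by (intro add Cons.IH; rule Cons.prems) simp_all
qed simp

lemma unshuffle_cong:
  assumes "\<And>A B. mset A + mset B = mset F \<Longrightarrow> f A B = g A B"
  shows "unshuffle F f = unshuffle F g"
  using assms
proof (induction F arbitrary: f g)
  case (Cons x F)
  show ?case
    unfolding unshuffle.simps by (intro arg_cong2[where f
        = "(+)"] Cons.IH; rule Cons.prems) simp_all
qed simp

text \<open>Cocommutativity: exchanging the parts exchanges the two summands of the
  recursion.\<close>

lemma unshuffle_commute: "unshuffle F f = unshuffle F (\<lambda>A B. f B A)"
proof (induction F arbitrary: f)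
  case (Cons x F)
  have "unshuffle (x # F) f = unshuffle F (\<lambda>A B. f (x # B) A) + unshuffle F (\<lambda>A B. f B (x # A))"
    unfolding unshuffle.simps by (rule arg_cong2[where f = "(+)"]; rule Cons.IH)
  then show ?case by (simp add: add.commute)
qed simp

lemma unshuffle_swap: "unshuffle F (\<lambda>A B. unshuffle G (\<lambda>C D. f A B C D))
    = unshuffle G (\<lambda>C D. unshuffle F (\<lambda>A B. f A B C D))"
  by (induction F arbitrary: f) (simp_all add: unshuffle_add)

text \<open>Coassociativity: on either side each tree is sent independently to one of three
  parts.\<close>

lemma unshuffle_assoc:
  "unshuffle F (\<lambda>A C. unshuffle A (\<lambda>A1 A2. f A1 A2 C))
      = unshuffle F (\<lambda>A C. unshuffle C (\<lambda>C1 C2. f A C1 C2))"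
  by (induction F arbitrary: f) (simp_all add: unshuffle_add algebra_simps)

lemma unshuffle_commute_inner:
  "unshuffle F (\<lambda>A B. unshuffle B (\<lambda>C D. f A C D))
      = unshuffle F (\<lambda>A B. unshuffle B (\<lambda>C D. f C A D))"
proof -
  have "unshuffle F (\<lambda>A B. unshuffle B (\<lambda>C D. f A C D))
      = unshuffle F (\<lambda>A B. unshuffle A (\<lambda>C D. f C D B))"
    by (rule unshuffle_assoc[symmetric])
  also have "\<dots> = unshuffle F (\<lambda>A B. unshuffle A (\<lambda>C D. f D C B))"
    by (rule unshuffle_cong, rule unshuffle_commute)
  also have "\<dots> = unshuffle F (\<lambda>A B. unshuffle B (\<lambda>C D. f C A D))"
    by (rule unshuffle_assoc)
  finally show ?thesis .
qed

text \<open>Splitting into four parts is symmetric in the two middle ones: once the first part is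
  peeled off, this is a commutation among the remaining three. It supplies the middle interchange in
  the compatibility of product and coproduct.\<close>

lemma unshuffle_exchange:
  "unshuffle F (\<lambda>A B. unshuffle A (\<lambda>A1 A2. unshuffle B (\<lambda>B1 B2. f A1 A2 B1 B2))) =
   unshuffle F (\<lambda>A B. unshuffle A (\<lambda>A1 A2. unshuffle B (\<lambda>B1 B2. f A1 B1 A2 B2)))"
proof -
  have "unshuffle F (\<lambda>A B. unshuffle A (\<lambda>A1 A2. unshuffle B (\<lambda>B1 B2. f A1 A2 B1 B2)))
      = unshuffle F (\<lambda>A1 C. unshuffle C (\<lambda>A2 B. unshuffle B (\<lambda>B1 B2. f A1 A2 B1 B2)))"
    by (rule unshuffle_assoc)
  also have "\<dots> = unshuffle F (\<lambda>A1 C. unshuffle C (\<lambda>A2 B. unshuffle B (\<lambda>B1 B2. f A1 B1 A2 B2)))"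
    by (rule unshuffle_cong, rule unshuffle_commute_inner)
  also have "\<dots> = unshuffle F (\<lambda>A B. unshuffle A (\<lambda>A1 A2. unshuffle B (\<lambda>B1 B2. f A1 B1 A2 B2)))"
    by (rule unshuffle_assoc[symmetric])
  finally show ?thesis .
qed

lemma unshuffle_append:
  "unshuffle (F @ G) f = unshuffle F (\<lambda>A B. unshuffle G (\<lambda>C D. f (A @ C) (B @ D)))"
  by (induction F arbitrary: f) simp_all

lemma unshuffle_Nil_right: "unshuffle F (\<lambda>A B. if B = [] then f A else 0) = f F"
  by (induction F arbitrary: f) simp_all

lemma unshuffle_Nil_left: "unshuffle F (\<lambda>A B. if A = [] then f B else 0) = f F"
  by (induction F arbitrary: f) simp_all

lemma unshuffle_map: "unshuffle (map h F) f = unshuffle F (\<lambda>A B. f (map h A) (map h B))"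
  by (induction F arbitrary: f) simp_all

section \<open>Grafting and the Grossman--Larson product of planar forests\<close>

text \<open>The first argument is grafted onto the second, as a sum in the sense of \<^const>\<open>unshuffle\<close>.\<close>

primrec graft_tree :: "'a forest \<Rightarrow> 'a tree \<Rightarrow> ('a tree \<Rightarrow> 'm::comm_monoid_add) \<Rightarrow> 'm"
    and graft_forest :: "'a forest \<Rightarrow> 'a forest \<Rightarrow> ('a forest \<Rightarrow> 'm) \<Rightarrow> 'm" where
  "graft_tree F (Black ts) f = unshuffle F (\<lambda>A B. graft_forest B ts (\<lambda>us. f (Black (A @ us))))"
| "graft_tree F (Num a) f = (if F = [] then f (Num a) else 0)"
| "graft_forest F [] f = (if F = [] then f [] else 0)"
| "graft_forest F (t # ts) f
    = unshuffle F (\<lambda>A B. graft_tree A t (\<lambda>u. graft_forest B ts (\<lambda>us. f (u # us))))"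

text \<open>The induction rule of the nested datatype speaks of members of the list of children.
  This mutual form matches the simultaneous recursion on a tree and on a forest that grafting and
  attachment use.\<close>

lemma tree_forest_induct [case_names Black Num Nil Cons]:
  assumes "\<And>ts. Q ts \<Longrightarrow> P (Black ts)" "\<And>a. P (Num a)"
    and "Q []" "\<And>t ts. P t \<Longrightarrow> Q ts \<Longrightarrow> Q (t # ts)"
  shows "P t" "Q ts"
proof -
  have P: "P t" for t
  proof (induction t)
    case (Black ts)
    have "Q us" if "set us \<subseteq> set ts" for us
      using that by (induction us) (auto intro: assms Black)
    then show ?case using assms(1) by blast
  qed (rule assms)
  then show "P t" .
  show "Q ts" by (induction ts) (auto intro: assms P)
qed

lemma graft_0 [simp]:
  "graft_tree F t (\<lambda>_. 0 :: 'm::comm_monoid_add) = 0"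
  "graft_forest F ts (\<lambda>_. 0 :: 'm) = 0"
  by (induction t and ts arbitrary: F and F rule: tree_forest_induct) simp_all

lemma graft_add:
  fixes f g :: "'a tree \<Rightarrow> 'm::comm_monoid_add" and f' g' :: "'a forest \<Rightarrow> 'm"
  shows "graft_tree F t (\<lambda>x. f x + g x) = graft_tree F t f + graft_tree F t g"
    "graft_forest F ts (\<lambda>y. f' y + g' y) = graft_forest F ts f' + graft_forest F ts g'"
  by (induction t and ts arbitrary: F f g and F f' g' rule: tree_forest_induct)
    (simp_all add: unshuffle_add)

text \<open>In contrast to unshuffling, grafting can be an empty sum, namely when something is
  grafted onto a numbered leaf or onto the empty forest. Hence additivity of \<open>L\<close> is
  accompanied by \<open>L 0 = 0\<close>.\<close>

lemma graft_hom:
  fixes L :: "'m::comm_monoid_add \<Rightarrow> 'n::comm_monoid_add"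
    and f :: "'a tree \<Rightarrow> 'm" and f' :: "'a forest \<Rightarrow> 'm"
  assumes "\<And>x y. L (x + y) = L x + L y" "L 0 = 0"
  shows "L (graft_tree F t f) = graft_tree F t (\<lambda>x. L (f x))"
    "L (graft_forest F ts f') = graft_forest F ts (\<lambda>x. L (f' x))"
  by (induction t and ts arbitrary: F f and F f' rule: tree_forest_induct)
    (simp_all add: assms(2) unshuffle_hom[where L = L, OF assms(1)])

section \<open>Labels under splitting and grafting\<close>

lemma labels_Nil [simp]: "labels [] = []"
  and labels_Cons [simp]: "labels (t # F) = tree_labels t @ labels F"
  and labels_append [simp]: "labels (F @ G) = labels F @ labels G"
  and tree_labels_Black: "tree_labels (Black F) = labels F"
  by (simp_all add: labels_def)

lemma mset_labels: "mset (labels F) = (\<Sum>t\<in>#mset F. mset (tree_labels t))"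
  by (induction F) simp_all

lemma mset_labels_split:
  assumes "mset A + mset B = mset F"
  shows "mset (labels F) = mset (labels A) + mset (labels B)"
  unfolding mset_labels assms[symmetric] by simp

text \<open>Grafting adds up label multisets and keeps the number of trees of the forest grafted
  onto. The labels later decide which terms are exotic; the length decides which terms are
  empty.\<close>

lemma graft_cong:
  fixes f g :: "'a tree \<Rightarrow> 'm::comm_monoid_add" and f' g' :: "'a forest \<Rightarrow> 'm"
  shows "(\<And>x. mset (tree_labels x) = mset (labels F) + mset (tree_labels t) \<Longrightarrow> f x = g x)
      \<Longrightarrow> graft_tree F t f = graft_tree F t g"
    and "(\<And>X. mset (labels X) = mset (labels F) + mset (labels ts) \<Longrightarrow> length X = length ts
      \<Longrightarrow> f' X = g' X) \<Longrightarrow> graft_forest F ts f' = graft_forest F ts g'"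
proof (induction t and ts arbitrary: F f g and F f' g' rule: tree_forest_induct)
  case (Black ts)
  show ?case
    unfolding graft_tree.simps
    by (rule unshuffle_cong, rule Black.IH, rule Black.prems)
      (simp add: tree_labels_Black mset_labels_split del: tree_labels.simps)
next
  case (Cons t ts)
  show ?case
    unfolding graft_forest.simps
    by (rule unshuffle_cong, rule Cons.IH(1), rule Cons.IH(2), rule Cons.prems)
      (simp_all add: mset_labels_split)
qed simp_all

text \<open>Naturality in the labels, from which independence of the chosen representatives will
  follow.\<close>

lemma graft_map:
  fixes f :: "'b tree \<Rightarrow> 'm::comm_monoid_add" and f' :: "'b forest \<Rightarrow> 'm" and h :: "'a \<Rightarrow> 'b"
  shows "graft_tree (relabel h F) (map_tree h t) f = graft_tree F t (\<lambda>x. f (map_tree h x))"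
  "graft_forest (relabel h F) (relabel h ts) f' = graft_forest F ts (\<lambda>x. f' (relabel h x))"
  unfolding relabel_def
  by (induction t and ts arbitrary: F f and F f' rule: tree_forest_induct)
    (simp_all add: unshuffle_map)

section \<open>Interchange laws for grafting, concatenation and unshuffling\<close>

lemma graft_tree_unshuffle: "graft_tree F t (\<lambda>x. unshuffle G (f x))
    = unshuffle G (\<lambda>A B. graft_tree F t (\<lambda>x. f x A B))"
  by (induction G arbitrary: f) (simp_all add: graft_add)

lemma graft_forest_unshuffle: "graft_forest F ts (\<lambda>x. unshuffle G (f x))
    = unshuffle G (\<lambda>A B. graft_forest F ts (\<lambda>x. f x A B))"
  by (induction G arbitrary: f) (simp_all add: graft_add)

lemma graft_swap:
  fixes k :: "'a tree \<Rightarrow> 'b forest \<Rightarrow> 'm::comm_monoid_add" and k' :: "'a forest \<Rightarrow> 'b forest \<Rightarrow> 'm"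
  shows "graft_tree F t (\<lambda>x. graft_forest G us (k x))
      = graft_forest G us (\<lambda>y. graft_tree F t (\<lambda>x. k x y))"
    "graft_forest F ts (\<lambda>x. graft_forest G us (k' x))
        = graft_forest G us (\<lambda>y. graft_forest F ts (\<lambda>x. k' x y))"
  by (induction t and ts arbitrary: F k and F k' rule: tree_forest_induct)
    (simp_all add: graft_forest_unshuffle)

lemma graft_Nil [simp]:
  fixes f :: "'a tree \<Rightarrow> 'm::comm_monoid_add" and f' :: "'a forest \<Rightarrow> 'm"
  shows "graft_tree [] t f = f t" "graft_forest [] ts f' = f' ts"
  by (induction t and ts arbitrary: f and f' rule: tree_forest_induct) simp_all

text \<open>Each tree of \<open>F\<close> chooses between the head tree, the rest of
  \<open>ts\<close>, and \<open>us\<close>; coassociativity regroups these three choices.\<close>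

lemma graft_forest_append:
  "graft_forest F (ts @ us) f =
    unshuffle F (\<lambda>A B. graft_forest A ts (\<lambda>X. graft_forest B us (\<lambda>Y. f (X @ Y))))"
proof (induction ts arbitrary: F f)
  case Nil
  have "unshuffle F (\<lambda>A B. graft_forest A [] (\<lambda>X. graft_forest B us (\<lambda>Y. f (X @ Y))))
      = unshuffle F (\<lambda>A B. if A = [] then graft_forest B us f else 0)"
    by (rule unshuffle_cong) simp
  then show ?case by (simp only: unshuffle_Nil_left append_Nil)
next
  case (Cons t ts)
  have "graft_forest F ((t # ts) @ us) f = unshuffle F (\<lambda>A B. unshuffle B (\<lambda>C D.
      graft_tree A t (\<lambda>u. graft_forest C ts (\<lambda>X. graft_forest D us (\<lambda>Y. f (u # X @ Y))))))"
    by (simp only: append_Cons graft_forest.simps Cons graft_tree_unshuffle)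
  also have "\<dots> = unshuffle F (\<lambda>A B. unshuffle A (\<lambda>A C.
      graft_tree A t (\<lambda>u. graft_forest C ts (\<lambda>X. graft_forest B us (\<lambda>Y. f (u # X @ Y))))))"
    by (rule unshuffle_assoc[symmetric])
  finally show ?case by simp
qed

text \<open>Grafting leaves the trees of \<open>ts\<close> in place as the trees of the result.
  Splitting the result therefore splits \<open>ts\<close> together with the trees grafted onto each
  part.\<close>

lemma graft_forest_coprod:
  "graft_forest F ts (\<lambda>X. unshuffle X f) =
    unshuffle F (\<lambda>A B. unshuffle ts (\<lambda>T U. graft_forest A T (\<lambda>X. graft_forest B U (f X))))"
proof (induction ts arbitrary: F f)
  case Nil
  have "unshuffle F (\<lambda>A B. unshuffle [] (\<lambda>T U. graft_forest A T (\<lambda>X. graft_forest B U (f X))))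
     = unshuffle F (\<lambda>A B. if A = [] then (if B = [] then f [] [] else 0) else 0)"
    by (rule unshuffle_cong) simp
  then show ?case by (simp only: unshuffle_Nil_left) simp
next
  case (Cons t ts)
  let ?g = "\<lambda>A T B U k. graft_forest A T (\<lambda>X. graft_forest B U (k X))"
  have "graft_forest F (t # ts) (\<lambda>X. unshuffle X f)
     = unshuffle F (\<lambda>A B. graft_tree A t (\<lambda>u. graft_forest B ts (\<lambda>us. unshuffle us
         (\<lambda>X. f (u # X)))))
     + unshuffle F (\<lambda>A B. graft_tree A t (\<lambda>u. graft_forest B ts (\<lambda>us. unshuffle us
         (\<lambda>X Y. f X (u # Y)))))"
    by (simp add: graft_add unshuffle_add)
  also have "unshuffle F (\<lambda>A B. graft_tree A t (\<lambda>u. graft_forest B ts (\<lambda>us. unshuffle us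
      (\<lambda>X. f (u # X)))))
     = unshuffle F (\<lambda>A B. unshuffle B (\<lambda>C D. unshuffle ts (\<lambda>T U. graft_tree A t (\<lambda>u. ?g C T D U
         (\<lambda>X. f (u # X))))))"
    by (simp only: Cons graft_tree_unshuffle)
  also have "\<dots>
      = unshuffle F (\<lambda>A B. unshuffle A (\<lambda>A1 A2. unshuffle ts (\<lambda>T U. graft_tree A1 t
      (\<lambda>u. ?g A2 T B U (\<lambda>X. f (u # X))))))"
    by (rule unshuffle_assoc[symmetric])
  also have "\<dots>
      = unshuffle F (\<lambda>A B. unshuffle ts (\<lambda>T U. unshuffle A (\<lambda>A1 A2. graft_tree A1 t
      (\<lambda>u. ?g A2 T B U (\<lambda>X. f (u # X))))))"
    by (rule unshuffle_cong, rule unshuffle_swap)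
  also have "unshuffle F (\<lambda>A B. graft_tree A t (\<lambda>u. graft_forest B ts (\<lambda>us. unshuffle us
      (\<lambda>X Y. f X (u # Y)))))
     = unshuffle F (\<lambda>A B. unshuffle B (\<lambda>C D. unshuffle ts (\<lambda>T U. graft_tree A t (\<lambda>u. ?g C T D U
         (\<lambda>X Y. f X (u # Y))))))"
    by (simp only: Cons graft_tree_unshuffle)
  \<comment> \<open>In this summand the head tree goes to the right part, so its share
    \<open>A\<close> of the grafted trees has to stand next to \<open>D\<close> instead of
    \<open>C\<close>. The summand before needed only coassociativity.\<close>
  also have "\<dots>
      = unshuffle F (\<lambda>C B. unshuffle B (\<lambda>A D. unshuffle ts (\<lambda>T U. graft_tree A t (\<lambda>u. ?g C T D U
      (\<lambda>X Y. f X (u # Y))))))"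
    by (rule unshuffle_commute_inner)
  also have "\<dots>
      = unshuffle F (\<lambda>C B. unshuffle ts (\<lambda>T U. unshuffle B (\<lambda>A D. graft_tree A t (\<lambda>u. ?g C T D U
      (\<lambda>X Y. f X (u # Y))))))"
    by (rule unshuffle_cong, rule unshuffle_swap)
  finally show ?case
    by (simp add: graft_swap(1) graft_forest_unshuffle unshuffle_add)
qed

section \<open>The Grossman-Larson product as a formal sum\<close>

definition gl_sum :: "'a forest \<Rightarrow> 'a forest \<Rightarrow> ('a forest \<Rightarrow> 'm::comm_monoid_add) \<Rightarrow> 'm" where
  "gl_sum F G f = unshuffle F (\<lambda>A B. graft_forest B G (\<lambda>X. f (A @ X)))"

lemma gl_sum_0 [simp]: "gl_sum F G (\<lambda>_. 0) = 0"
  by (simp add: gl_sum_def)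

lemma gl_sum_hom:
  assumes "\<And>x y. L (x + y) = L x + L y" "L 0 = 0"
  shows "L (gl_sum F G f) = gl_sum F G (\<lambda>X. L (f X))"
  unfolding gl_sum_def unshuffle_hom[where L = L, OF assms(1)] graft_hom(2)[where L
      = L, OF assms] ..

lemma gl_sum_cong:
  assumes "\<And>H. mset (labels H) = mset (labels F) + mset (labels G) \<Longrightarrow> length G \<le> length H \<Longrightarrow> f H
      = g H"
  shows "gl_sum F G f = gl_sum F G g"
  unfolding gl_sum_def
  by (rule unshuffle_cong, rule graft_cong(2), rule assms) (simp_all add: mset_labels_split)

lemma gl_sum_Nil [simp]: "gl_sum [] G f = f G" "gl_sum F [] f = f F"
proof -
  show "gl_sum [] G f = f G" by (simp add: gl_sum_def)
  have "gl_sum F [] f = unshuffle F (\<lambda>A B. if B = [] then f A else 0)"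
    unfolding gl_sum_def by (rule unshuffle_cong) simp
  then show "gl_sum F [] f = f F" by (simp only: unshuffle_Nil_right)
qed

lemma gl_sum_relabel:
  "gl_sum (relabel h F) (relabel h G) f = gl_sum F G (\<lambda>H. f (relabel h H))"
proof -
  have "gl_sum (relabel h F) (relabel h G) f =
      unshuffle F (\<lambda>A B. graft_forest (relabel h B) (relabel h G) (\<lambda>X. f (relabel h A @ X)))"
    unfolding gl_sum_def relabel_def[of h F] unshuffle_map unfolding relabel_def ..
  also have "\<dots> = gl_sum F G (\<lambda>H. f (relabel h H))"
    unfolding graft_map(2) gl_sum_def by (simp add: relabel_def)
  finally show ?thesis .
qed

lemma graft_tree_Black: "graft_tree F (Black ts) f = gl_sum F ts (\<lambda>X. f (Black X))"
  by (simp add: gl_sum_def)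

text \<open>Every term has at least as many trees as \<open>G\<close>, so an empty term forces
  \<open>G = []\<close>, and then the product is \<open>F\<close>. This becomes multiplicativity of
  the counit.\<close>

lemma gl_sum_eq_Nil: "gl_sum F G (\<lambda>H. if H = [] then c else 0) = (if F = [] \<and> G = [] then c else 0)"
proof (cases G)
  case (Cons t ts)
  have "gl_sum F G (\<lambda>H. if H = [] then c else 0) = gl_sum F G (\<lambda>H. 0)"
    by (rule gl_sum_cong) (auto simp: Cons)
  then show ?thesis using Cons by simp
qed simp

lemma graft_tree_gl_sum:
  "graft_tree A t (\<lambda>x. gl_sum F G (f x)) = gl_sum F G (\<lambda>H. graft_tree A t (\<lambda>x. f x H))"
  by (simp add: gl_sum_def graft_tree_unshuffle graft_swap(1))

text \<open>A term consists of staying trees followed by a grafted forest, and the two are split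
  separately. This cuts \<open>F\<close> into four parts, of which the middle two are then
  interchanged.\<close>

lemma gl_sum_coprod:
  "gl_sum F G (\<lambda>H. unshuffle H f) =
    unshuffle F (\<lambda>A B. unshuffle G (\<lambda>C D. gl_sum A C (\<lambda>X. gl_sum B D (\<lambda>Y. f X Y))))"
proof -
  have "gl_sum F G (\<lambda>H. unshuffle H f)
      = unshuffle F (\<lambda>A B. unshuffle A (\<lambda>A1 A2. unshuffle B (\<lambda>B1 B2. unshuffle G (\<lambda>C D.
     graft_forest B1 C (\<lambda>X. graft_forest B2 D (\<lambda>Y. f (A1 @ X) (A2 @ Y)))))))"
    by (simp only: gl_sum_def unshuffle_append graft_forest_unshuffle graft_forest_coprod)
  also have "\<dots> = unshuffle F (\<lambda>A B. unshuffle A (\<lambda>A1 A2. unshuffle B (\<lambda>B1 B2. unshuffle G (\<lambda>C D.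
     graft_forest A2 C (\<lambda>X. graft_forest B2 D (\<lambda>Y. f (A1 @ X) (B1 @ Y)))))))"
    by (rule unshuffle_exchange)
  also have "\<dots> = unshuffle F (\<lambda>A B. unshuffle G (\<lambda>C D. unshuffle A (\<lambda>A1 A2. unshuffle B (\<lambda>B1 B2.
     graft_forest A2 C (\<lambda>X. graft_forest B2 D (\<lambda>Y. f (A1 @ X) (B1 @ Y)))))))"
    by (simp only: unshuffle_swap[where G = G])
  also have "\<dots> = unshuffle F (\<lambda>A B. unshuffle G (\<lambda>C D. gl_sum A C (\<lambda>X. gl_sum B D (\<lambda>Y. f X Y))))"
    by (simp only: gl_sum_def graft_forest_unshuffle)
  finally show ?thesis .
qed

text \<open>Stated for one \<open>K\<close> because grafting onto \<open>Black K\<close> is the product with \<open>K\<close>: this is the step of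
  the induction below.\<close>

lemma gl_sum_assoc_if:
  assumes graft: "\<And>F G f. graft_forest G K (\<lambda>X. graft_forest F X f) =
    (gl_sum F G (\<lambda>H. graft_forest H K f) :: 'm::comm_monoid_add)"
  shows "gl_sum G K (\<lambda>H. gl_sum F H f) = (gl_sum F G (\<lambda>H. gl_sum H K f) :: 'm)"
proof -
  \<comment> \<open>Here \<open>F1\<close> stays, \<open>F2\<close> falls on the trees
    \<open>G1\<close> that stay beside \<open>K\<close>, and \<open>F3\<close> falls on the result
    of grafting \<open>G2\<close> onto \<open>K\<close>.\<close>
  have "gl_sum G K (\<lambda>H. gl_sum F H f)
      = unshuffle G (\<lambda>G1 G2. unshuffle F (\<lambda>F1 R. unshuffle R (\<lambda>F2 F3.
      graft_forest G2 K (\<lambda>X. graft_forest F2 G1 (\<lambda>Y. graft_forest F3 X (\<lambda>Z. f (F1 @ Y @ Z)))))))"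
    by (simp only: gl_sum_def graft_forest_append graft_forest_unshuffle)
  also have "\<dots> = unshuffle G (\<lambda>G1 G2. unshuffle F (\<lambda>F1 R. unshuffle R (\<lambda>F2 F3.
      graft_forest F2 G1 (\<lambda>Y. graft_forest G2 K (\<lambda>X. graft_forest F3 X (\<lambda>Z. f (F1 @ Y @ Z)))))))"
    by (rule unshuffle_cong)+ (rule graft_swap)
  \<comment> \<open>By the hypothesis on \<open>K\<close>, grafting \<open>G2\<close> and then
    \<open>F3\<close> is grafting their product.\<close>
  also have "\<dots> = unshuffle F (\<lambda>F1 R. unshuffle R (\<lambda>F2 F3. unshuffle G (\<lambda>G1 G2.
      graft_forest F2 G1 (\<lambda>Y. gl_sum F3 G2 (\<lambda>H. graft_forest H K (\<lambda>Z. f (F1 @ Y @ Z)))))))"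
    unfolding graft by (simp only: unshuffle_swap[where F = G])
  also have "\<dots> = unshuffle F (\<lambda>A B. unshuffle A (\<lambda>A1 A2. unshuffle G (\<lambda>C D.
      graft_forest A2 C (\<lambda>X. gl_sum B D (\<lambda>H. graft_forest H K (\<lambda>Z. f (A1 @ X @ Z)))))))"
    by (rule unshuffle_assoc[symmetric])
  also have "\<dots> = unshuffle F (\<lambda>A B. unshuffle G (\<lambda>C D. gl_sum A C (\<lambda>X.
      gl_sum B D (\<lambda>H. graft_forest H K (\<lambda>Z. f (X @ Z))))))"
    by (simp only: unshuffle_swap[where G
        = G] gl_sum_def[of _ _ "\<lambda>X. gl_sum _ _ (f X)" for f] append_assoc)
  also have "\<dots> = gl_sum F G (\<lambda>H. unshuffle H (\<lambda>A B. graft_forest B K (\<lambda>X. f (A @ X))))"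
    by (rule gl_sum_coprod[symmetric])
  finally show ?thesis
    by (simp only: gl_sum_def[of _ K])
qed

text \<open>Grafting is a module action of the product. Below a black root this is associativity of
  the product with the children; for a nonempty forest it follows from \<open>gl_sum_coprod\<close>,
  since the trees of a product have to be shared between the head and the tail. Numbered leaves and
  the empty forest accept only the empty forest, which is \<open>gl_sum_eq_Nil\<close>.\<close>

lemma graft_graft:
  fixes f :: "'a tree \<Rightarrow> 'm::comm_monoid_add" and f' :: "'a forest \<Rightarrow> 'm"
  shows "graft_tree G t (\<lambda>x. graft_tree F x f) = gl_sum F G (\<lambda>H. graft_tree H t f)"
    "graft_forest G ts (\<lambda>X. graft_forest F X f') = gl_sum F G (\<lambda>H. graft_forest H ts f')"
proof (induction t and ts arbitrary: F G f and F G f' rule: tree_forest_induct)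
  case (Black ts)
  then show ?case
    unfolding graft_tree_Black by (rule gl_sum_assoc_if)
next
  case (Cons t ts)
  have "graft_forest G (t # ts) (\<lambda>X. graft_forest F X f') =
    unshuffle G (\<lambda>G1 G2. unshuffle F (\<lambda>F1 F2. graft_tree G1 t (\<lambda>u. graft_forest G2 ts (\<lambda>us.
      graft_tree F1 u (\<lambda>v. graft_forest F2 us (\<lambda>vs. f' (v # vs)))))))"
    by (simp only: graft_forest.simps graft_forest_unshuffle graft_tree_unshuffle)
  also have "\<dots> =
    unshuffle G (\<lambda>G1 G2. unshuffle F (\<lambda>F1 F2. graft_tree G1 t (\<lambda>u. graft_tree F1 u (\<lambda>v.
        graft_forest G2 ts (\<lambda>us.
       graft_forest F2 us (\<lambda>vs. f' (v # vs)))))))"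
    by (simp only: graft_swap(1))
  also have "\<dots> = unshuffle G (\<lambda>G1 G2. unshuffle F (\<lambda>F1 F2. gl_sum F1 G1 (\<lambda>X. graft_tree X t (\<lambda>v.
      gl_sum F2 G2 (\<lambda>Y. graft_forest Y ts (\<lambda>vs. f' (v # vs)))))))"
    by (simp only: Cons.IH)
  also have "\<dots> = unshuffle F (\<lambda>A B. unshuffle G (\<lambda>C D. gl_sum A C (\<lambda>X. gl_sum B D (\<lambda>Y.
      graft_tree X t (\<lambda>v. graft_forest Y ts (\<lambda>vs. f' (v # vs)))))))"
    by (simp only: unshuffle_swap[where F = G] graft_tree_gl_sum)
  also have "\<dots> = gl_sum F G (\<lambda>H. graft_forest H (t # ts) f')"
    unfolding graft_forest.simps by (rule gl_sum_coprod[symmetric])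
  finally show ?case .
qed (simp_all add: gl_sum_eq_Nil)

lemma gl_sum_assoc: "gl_sum G K (\<lambda>H. gl_sum F H f) = gl_sum F G (\<lambda>H. gl_sum H K f)"
  by (rule gl_sum_assoc_if) (rule graft_graft)

section \<open>Sums over grafting maps\<close>

text \<open>A map enters only through the subsequences on its fibres, so recursion on
  \<open>F\<close> or on \<open>V\<close> requires no renumbering of positions inside
  \<open>h\<close>. Positions outside \<open>F\<close>, where the map is \<open>undefined\<close>,
  are ignored by \<open>nths\<close>.\<close>

definition distribute :: "'v set \<Rightarrow> 'a list \<Rightarrow> (('v \<Rightarrow> 'a list) \<Rightarrow> 'm::comm_monoid_add) \<Rightarrow> 'm" where
  "distribute V F h = (\<Sum>\<phi> \<in> {..<length F} \<rightarrow>\<^sub>E V. h (\<lambda>v. nths F {i. \<phi> i = v}))"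

lemma distribute_Nil [simp]: "distribute V [] h = h (\<lambda>_. [])"
  by (simp add: distribute_def)

lemma distribute_Cons:
  fixes V :: "'v set" and F :: "'a list"
  shows "distribute V (x # F) h = (\<Sum>v\<in>V. distribute V F (\<lambda>g. h (g(v := x # g v))))"
proof -
  let ?n = "length F"
  \<comment> \<open>\<open>c\<close> prepends a value at position 0 and \<open>d\<close> splits it
    off again; they are mutually inverse.\<close>
  define c :: "'v \<times> (nat \<Rightarrow> 'v) \<Rightarrow> nat \<Rightarrow> 'v" where "c p = case_nat (fst p) (snd p)" for p
  define d :: "(nat \<Rightarrow> 'v) \<Rightarrow> 'v \<times> (nat \<Rightarrow> 'v)" where "d \<phi> = (\<phi> 0, \<lambda>i. \<phi> (Suc i))" for \<phi>
  have c [simp]: "c p 0 = fst p" "c p (Suc i) = snd p i" for p i by (simp_all add: c_def)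
  have dc: "d (c p) = p" for p by (simp add: d_def)
  have "c (d \<phi>) i = \<phi> i" for \<phi> i by (cases i) (simp_all add: d_def)
  then have cd: "c (d \<phi>) = \<phi>" for \<phi> by blast
  have c_in: "c p \<in> {..<length (x # F)} \<rightarrow>\<^sub>E V" if "p \<in> V \<times> ({..<?n} \<rightarrow>\<^sub>E V)" for p
  proof (rule PiE_I)
    have p: "fst p \<in> V" "snd p \<in> {..<?n} \<rightarrow>\<^sub>E V"
      using that by (auto simp only: mem_Times_iff)
    show "c p i \<in> V" if "i \<in> {..<length (x # F)}" for i
      using that p(1) PiE_mem[OF p(2)] by (cases i) simp_all
    show "c p i = undefined" if "i \<notin> {..<length (x # F)}" for i
      using that PiE_arb[OF p(2)] by (cases i) simp_all
  qed
  have d_in: "d \<phi> \<in> V \<times> ({..<?n} \<rightarrow>\<^sub>E V)" if "\<phi> \<in> {..<length (x # F)} \<rightarrow>\<^sub>E V" for \<phi>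
    using that by (auto simp: d_def intro!: PiE_I)
  have nths: "nths (x # F) {i. c p i = u} = ((\<lambda>u. nths F {i. snd p i
      = u})(fst p := x # nths F {i. snd p i = fst p})) u"
    for p u by (cases "u = fst p") (simp_all add: nths_Cons)
  have "(\<Sum>v\<in>V. distribute V F (\<lambda>g. h (g(v := x # g v)))) =
    (\<Sum>p \<in> V \<times> ({..<?n} \<rightarrow>\<^sub>E V). h (\<lambda>u. nths (x # F) {i. c p i = u}))"
    by (simp add: distribute_def sum.cartesian_product nths case_prod_beta' del: fun_upd_apply)
  also have "\<dots> = (\<Sum>\<phi> \<in> {..<length (x # F)} \<rightarrow>\<^sub>E V. h (\<lambda>v. nths (x # F) {i. \<phi> i = v}))"
    by (rule sum.reindex_bij_witness[where j = c and i = d]) (use c_in d_in cd dc in simp_all)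
  finally show ?thesis by (simp add: distribute_def)
qed

lemma distribute_cong:
  assumes "\<And>g. h g = h' g"
  shows "distribute V F h = distribute V F h'"
  using assms by (simp add: distribute_def)

lemma distribute_sum: "distribute V F (\<lambda>g. \<Sum>i\<in>I. h i g) = (\<Sum>i\<in>I. distribute V F (h i))"
  unfolding distribute_def by (rule sum.swap)

lemma unshuffle_sum: "unshuffle F (\<lambda>A B. \<Sum>i\<in>I. f i A B) = (\<Sum>i\<in>I. unshuffle F (f i))"
  by (induction F arbitrary: f) (simp_all add: sum.distrib)

text \<open>A map into a disjoint union amounts to the choice of the positions sent to
  \<open>V\<close>, which is an unshuffling, and a map on each of the two parts.\<close>

lemma distribute_Un:
  assumes "finite V" "finite W" "V \<inter> W = {}"
  shows "distribute (V \<union> W) F h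
      = unshuffle F (\<lambda>A B. distribute V A (\<lambda>g. distribute W B (\<lambda>g'. h (\<lambda>v.
      if v \<in> V then g v else g' v))))"
proof (induction F arbitrary: h)
  case (Cons x F)
  have V: "(\<lambda>v. if v \<in> V then (g(u := x # g u)) v else g' v) =
     (\<lambda>v. if v \<in> V then g v else g' v)(u := x # (if u \<in> V then g u else g' u))" if
         "u \<in> V" for u g g'
    using that by auto
  have W: "(\<lambda>v. if v \<in> V then g v else (g'(u := x # g' u)) v) =
     (\<lambda>v. if v \<in> V then g v else g' v)(u := x # (if u \<in> V then g u else g' u))" if
         "u \<in> W" for u g g'
    using that assms(3) by auto
  have "distribute (V \<union> W) (x # F) h
      = (\<Sum>u\<in>V. distribute (V \<union> W) F (\<lambda>g. h (g(u := x # g u)))) + (\<Sum>u\<in>W. distribute (V \<union> W) F (\<lambda>g.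
          h (g(u := x # g u))))"
    unfolding distribute_Cons by (rule sum.union_disjoint) (use assms in auto)
  also have "(\<Sum>u\<in>V. distribute (V \<union> W) F (\<lambda>g. h (g(u := x # g u)))) =
     unshuffle F (\<lambda>A B. distribute V (x # A) (\<lambda>g. distribute W B (\<lambda>g'. h (\<lambda>v.
         if v \<in> V then g v else g' v))))"
    unfolding distribute_Cons Cons.IH unshuffle_sum by (rule sum.cong[OF refl]) (simp only: V)
  also have "(\<Sum>u\<in>W. distribute (V \<union> W) F (\<lambda>g. h (g(u := x # g u)))) =
     unshuffle F (\<lambda>A B. distribute V A (\<lambda>g. distribute W (x # B) (\<lambda>g'. h (\<lambda>v.
         if v \<in> V then g v else g' v))))"
    unfolding distribute_Cons Cons.IH unshuffle_sum distribute_sum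
        by (rule sum.cong[OF refl]) (simp only: W)
  finally show ?case by simp
qed simp

text \<open>This removes the prefix that embeds a set of targets into a larger one:
  \<open>(#) i\<close> for the addresses in one tree, \<open>Some\<close> for all black nodes of a
  forest.\<close>

lemma distribute_image:
  assumes "inj j"
  shows "distribute (j ` V) F (\<lambda>g. h (\<lambda>v. g (j v))) = distribute V F h"
proof (induction F arbitrary: h)
  case (Cons x F)
  have upd: "(\<lambda>w. (g(j v := x # g (j v))) (j w)) = (\<lambda>w. g (j w))(v := x # g (j v))" for g v
    using assms by (auto simp: inj_eq)
  have "distribute (j ` V) F (\<lambda>g. h (\<lambda>w. (g(j v := x # g (j v))) (j w))) =
      distribute V F (\<lambda>g. h (g(v := x # g v)))" for v
    unfolding upd by (rule Cons.IH)
  moreover have "inj_on j V" using assms by (rule inj_on_subset) simp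
  ultimately show ?case
    by (simp only: distribute_Cons sum.reindex o_def)
qed simp

lemma distribute_empty: "distribute {} F h = (if F = [] then h (\<lambda>_. []) else 0)"
  by (cases F) (simp_all add: distribute_Cons)

lemma distribute_singleton: "distribute {u} F h = h ((\<lambda>_. [])(u := F))"
  by (induction F arbitrary: h) (simp_all add: distribute_Cons fun_upd_idem)

section \<open>Addresses of black nodes and attachment at them\<close>

lemma finite_black [simp]:
  fixes t :: "'a tree" and ts :: "'a forest"
  shows "finite (black_tree t)" "finite (black_forest ts i)"
  by (induction t and ts arbitrary: and i rule: tree_forest_induct) simp_all

text \<open>Used to see that addresses in the head tree differ from those in the tail.\<close>

lemma black_forest_hd: "i # v \<in> black_forest ts j \<Longrightarrow> j \<le> i"
proof (induction ts arbitrary: j)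
  case (Cons t ts)
  then show ?case using Cons.IH[of "Suc j"] by (auto dest: Suc_leD)
qed simp

lemma Nil_notin_black_forest [simp]: "[] \<notin> black_forest ts i"
  by (induction ts arbitrary: i) auto

lemma attach_cong:
  fixes t :: "'a tree" and ts :: "'a forest"
  shows "(\<And>v. v \<in> black_tree t \<Longrightarrow> g v = h v) \<Longrightarrow> attach_tree t g = attach_tree t h"
  "(\<And>v. v \<in> black_forest ts i \<Longrightarrow> g' v = h' v) \<Longrightarrow> attach_forest ts i g' = attach_forest ts i h'"
proof (induction t and ts arbitrary: g h and i g' h' rule: tree_forest_induct)
  case (Black ts)
  have "g [] = h []" "attach_forest ts 0 g = attach_forest ts 0 h"
    by (rule Black.prems, simp) (rule Black.IH, rule Black.prems, simp)
  then show ?case by simp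
next
  case (Cons t ts)
  have "attach_tree t (\<lambda>v. g' (i # v)) = attach_tree t (\<lambda>v. h' (i # v))"
    "attach_forest ts (Suc i) g' = attach_forest ts (Suc i) h'"
    by (rule Cons.IH, rule Cons.prems, simp)+
  then show ?case by simp
qed simp_all

text \<open>The black nodes of a tree are the root and those of its children; those of a nonempty
  forest lie in its head or in its tail. In both cases \<open>distribute_Un\<close> turns this
  disjoint union into the unshuffling in the recursion of \<open>graft_tree\<close> and
  \<open>graft_forest\<close>.\<close>

lemma distribute_attach:
  fixes f :: "'a tree \<Rightarrow> 'm::comm_monoid_add" and f' :: "'a forest \<Rightarrow> 'm"
  shows "distribute (black_tree t) F (\<lambda>g. f (attach_tree t g)) = graft_tree F t f"
    "distribute (black_forest ts i) F (\<lambda>g. f' (attach_forest ts i g)) = graft_forest F ts f'"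
proof (induction t and ts arbitrary: F f and F f' i rule: tree_forest_induct)
  case (Black ts)
  let ?W = "black_forest ts 0"
  have "attach_forest ts 0 (\<lambda>v. if v \<in> {[]} then g v else g' v) = attach_forest ts 0 g'" for g g'
    by (rule attach_cong) (auto split: if_splits)
  then have "distribute ({[]} \<union> ?W) F (\<lambda>g. f (attach_tree (Black ts) g)) =
     unshuffle F (\<lambda>A B. distribute ?W B (\<lambda>g. f (Black (A @ attach_forest ts 0 g))))"
    by (subst distribute_Un) (simp_all add: distribute_singleton)
  then show ?case by (simp add: Black.IH[where f' = "\<lambda>us. f (Black (_ @ us))"])
next
  case (Num a)
  then show ?case by (simp add: distribute_empty)
next
  case Nil
  then show ?case by (simp add: distribute_empty)
next
  case (Cons t ts)
  let ?V = "(#) i ` black_tree t" and ?W = "black_forest ts (Suc i)"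
  have disj: "?V \<inter> ?W = {}" by (auto dest: black_forest_hd)
  have att: "attach_forest ts (Suc i) (\<lambda>v. if v \<in> ?V then g v else g' v)
      = attach_forest ts (Suc i) g'"
    "attach_tree t (\<lambda>v. if i # v \<in> ?V then g (i # v) else g' (i # v))
        = attach_tree t (\<lambda>v. g (i # v))" for g g'
    by (rule attach_cong; use disj in auto)+
  have "distribute (black_forest (t # ts) i) F (\<lambda>g. f' (attach_forest (t # ts) i g)) =
     unshuffle F (\<lambda>A B. distribute ?V A (\<lambda>g. distribute ?W B (\<lambda>g'. f' (attach_tree t
         (\<lambda>v. g (i # v)) # attach_forest ts (Suc i) g'))))"
    unfolding black_forest.simps
        by (subst distribute_Un[OF _ _ disj])
        (simp_all only: att attach_forest.simps finite_black finite_imageI)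
  also have "\<dots>
      = unshuffle F (\<lambda>A B. distribute ?V A (\<lambda>g. graft_forest B ts (\<lambda>us. f' (attach_tree t
      (\<lambda>v. g (i # v)) # us))))"
    by (rule unshuffle_cong, rule distribute_cong, rule Cons.IH(2))
  also have "\<dots>
      = unshuffle F (\<lambda>A B. distribute (black_tree t) A (\<lambda>g. graft_forest B ts
      (\<lambda>us. f' (attach_tree t g # us))))"
    by (rule unshuffle_cong, rule distribute_image) simp
  also have "\<dots> = graft_forest F (t # ts) f'"
    unfolding graft_forest.simps by (rule unshuffle_cong, rule Cons.IH(1))
  finally show ?case .
qed

text \<open>Links the definition by grafting maps to the recursive sum: the target
  \<open>None\<close> collects the staying trees \<open>A\<close>, and the other targets distribute
  \<open>B\<close> over the black nodes.\<close>

lemma sum_graft: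
  "(\<Sum>\<phi> \<in> {..<length F} \<rightarrow>\<^sub>E targets G. f (graft F G \<phi>)) = gl_sum F G f"
proof -
  have "(\<Sum>\<phi> \<in> {..<length F} \<rightarrow>\<^sub>E targets G. f (graft F G \<phi>)) =
    distribute ({None} \<union> Some ` black_forest G 0) F (\<lambda>g. f (g None @ attach_forest G 0
        (\<lambda>v. g (Some v))))"
    by (simp add: distribute_def graft_def Let_def targets_def)
  also have "\<dots>
      = unshuffle F (\<lambda>A B. distribute (Some ` black_forest G 0) B (\<lambda>g. f (A @ attach_forest G 0
      (\<lambda>v. g (Some v)))))"
    by (subst distribute_Un) (auto simp: distribute_singleton)
  also have "\<dots>
      = unshuffle F (\<lambda>A B. distribute (black_forest G 0) B (\<lambda>g. f (A @ attach_forest G 0 g)))"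
    by (rule unshuffle_cong, rule distribute_image) simp
  also have "\<dots> = gl_sum F G f"
    unfolding gl_sum_def by (rule unshuffle_cong, rule distribute_attach)
  finally show ?thesis .
qed

text \<open>The subsets of positions of \<open>x # F\<close> that contain 0 and those that do not
  give the two summands of the recursion.\<close>

lemma sum_Pow_nths:
  "(\<Sum>I \<in> Pow {..<length F}. f (nths F I) (nths F ({..<length F} - I))) = unshuffle F f"
proof (induction F arbitrary: f)
  case (Cons x F)
  let ?P = "Pow {..<length F}" and ?n = "{..<Suc (length F)}"
  let ?g = "\<lambda>I. f (nths (x # F) I) (nths (x # F) (?n - I))"
  have n: "?n = insert 0 (Suc ` {..<length F})"
    by (simp add: lessThan_Suc_eq_insert_0)
  \<comment> \<open>Taking the preimage under \<open>Suc\<close> is a left inverse of both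
    maps.\<close>
  have inj: "inj_on ((`) Suc) ?P" "inj_on (\<lambda>I. insert 0 (Suc ` I)) ?P"
    by (rule inj_on_inverseI[where g = "\<lambda>A. {j. Suc j \<in> A}"], simp add: image_iff)+
  have nths: "nths (x # F) (Suc ` I) = nths F I" "nths (x # F) (insert 0 (Suc ` I)) = x # nths F I"
    "nths (x # F) (?n - Suc ` I) = x # nths F ({..<length F} - I)"
    "nths (x # F) (?n - insert 0 (Suc ` I)) = nths F ({..<length F} - I)" for I
    by (simp_all add: nths_Cons inj_image_mem_iff set_diff_eq)
  have "Pow ?n = (`) Suc ` ?P \<union> (\<lambda>I. insert 0 (Suc ` I)) ` ?P"
    unfolding n Pow_insert image_Pow_surj[OF refl, symmetric] image_image ..
  then have "sum ?g (Pow ?n) = sum ?g ((`) Suc ` ?P) + sum ?g ((\<lambda>I. insert 0 (Suc ` I)) ` ?P)"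
    by (simp only:) (rule sum.union_disjoint; auto)
  also have "sum ?g ((`) Suc ` ?P) = (\<Sum>I\<in>?P. f (nths F I) (x # nths F ({..<length F} - I)))"
    unfolding sum.reindex[OF inj(1)] o_def by (rule sum.cong[OF refl]) (simp only: nths)
  also have "sum ?g ((\<lambda>I. insert 0 (Suc ` I)) ` ?P)
      = (\<Sum>I\<in>?P. f (x # nths F I) (nths F ({..<length F} - I)))"
    unfolding sum.reindex[OF inj(2)] o_def by (rule sum.cong[OF refl]) (simp only: nths)
  finally have "sum ?g (Pow ?n) = unshuffle F (\<lambda>A B. f A (x # B)) + unshuffle F (\<lambda>A B. f (x # A) B)"
    unfolding Cons.IH[of "\<lambda>A. f (x # A)"] Cons.IH[of "\<lambda>A B. f A (x # B)"] .
  then show ?case by (simp add: add.commute)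
qed simp

section \<open>Exotic forests up to renumbering\<close>

lemma labels_relabel [simp]: "labels (relabel f F) = map f (labels F)"
proof -
  have "tree_labels (map_tree f t) = map f (tree_labels t)" for t
    by (induction t) (simp_all add: map_concat cong: map_cong)
  then show ?thesis by (simp add: labels_def relabel_def map_concat o_def)
qed

lemma relabel_cong:
  assumes "\<And>n. n \<in> set (labels F) \<Longrightarrow> f n = g n"
  shows "relabel f F = relabel g F"
  using assms by (auto simp: relabel_def labels_def set_tree_labels intro!: tree.map_cong)

lemma exotic_iff_count: "exotic F \<longleftrightarrow> (\<forall>n\<in>#mset (labels F). n > 0 \<and> count (mset (labels F)) n = 2)"
  by (simp add: exotic_def count_mset)

lemma exotic_Nil [simp]: "exotic []"
  by (simp add: exotic_def)

lemma exotic_pos: "exotic F \<Longrightarrow> n \<in> set (labels F) \<Longrightarrow> n > 0"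
  by (simp add: exotic_def)

text \<open>With disjoint labels, all occurrences of an integer lie on one side, so the condition
  that there are two of them can be checked there.\<close>

lemma exotic_mset_union:
  assumes "mset (labels H) = mset (labels F) + mset (labels G)"
    and "set (labels F) \<inter> set (labels G) = {}"
  shows "exotic H \<longleftrightarrow> exotic F \<and> exotic G"
proof -
  have 1: "count (mset (labels F)) n = 0" if "n \<in> set (labels G)" for n
    using assms(2) that by (auto simp: count_eq_zero_iff)
  have 2: "count (mset (labels G)) n = 0" if "n \<in> set (labels F)" for n
    using assms(2) that by (auto simp: count_eq_zero_iff)
  show ?thesis
    unfolding exotic_iff_count assms(1) by (simp add: ball_Un 1 2)
qed

text \<open>An exotic part already uses both occurrences of each of its integers and leaves none for
  the other part.\<close>

lemma exotic_split_disjoint: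
  assumes "exotic F" "mset (labels F) = mset (labels A) + mset (labels B)" "exotic A"
  shows "set (labels A) \<inter> set (labels B) = {}"
proof -
  have "n \<notin> set (labels B)" if A: "n \<in> set (labels A)" for n
  proof -
    have "n \<in># mset (labels F)"
      unfolding assms(2) using A by simp
    then have "count (mset (labels F)) n = 2"
      using assms(1) unfolding exotic_iff_count by blast
    moreover have "count (mset (labels A)) n = 2"
      using assms(3) A unfolding exotic_iff_count by simp
    ultimately have "count (mset (labels B)) n = 0"
      unfolding assms(2) by simp
    then show ?thesis by (simp add: count_eq_zero_iff)
  qed
  then show ?thesis by blast
qed

lemma exotic_relabel:
  assumes "inj_on f (set (labels F))" "\<And>n. n \<in> set (labels F) \<Longrightarrow> n > 0 \<and> f n > 0"
  shows "exotic (relabel f F) \<longleftrightarrow> exotic F"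
proof -
  have "count_list (map f xs) (f n)
      = count_list xs n" if "inj_on f (insert n (set xs))" for xs and n :: nat
    using that by (induction xs) (auto simp: inj_on_def)
  then have "count_list (map f (labels F)) (f n)
      = count_list (labels F) n" if "n \<in> set (labels F)" for n
    using assms(1) insert_absorb[OF that] by metis
  then show ?thesis using assms(2) by (auto simp: exotic_def)
qed

lemma exotic_rep: "exotic (rep_exotic_forest \<pi>)"
  using Quotient3_rep_reflp[OF Quotient3_exotic_forest, of \<pi>] by (simp add: renumbering_def)

lemma abs_rep [simp]: "abs_exotic_forest (rep_exotic_forest \<pi>) = \<pi>"
  by (rule Quotient3_abs_rep[OF Quotient3_exotic_forest])

lemma renumbering_refl: "exotic F \<Longrightarrow> renumbering F F"
  unfolding renumbering_def by (metis inj_on_id relabel_cong_id id_apply)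

lemma abs_eq_iff: "exotic F \<Longrightarrow> exotic G \<Longrightarrow> abs_exotic_forest F
    = abs_exotic_forest G \<longleftrightarrow> renumbering F G"
  using Quotient3_rel[OF Quotient3_exotic_forest, of F G] renumbering_refl by blast

lemma abs_relabel:
  assumes "exotic F" "inj_on f (set (labels F))" "\<And>n. n \<in> set (labels F) \<Longrightarrow> f n > 0"
  shows "abs_exotic_forest (relabel f F) = abs_exotic_forest F"
proof -
  have "exotic (relabel f F)"
    using exotic_relabel[OF assms(2)] assms exotic_pos by blast
  then show ?thesis
    using assms by (subst eq_commute) (auto simp: abs_eq_iff renumbering_def)
qed

lemma abs_relabelE:
  assumes "exotic F" "exotic G" "abs_exotic_forest F = abs_exotic_forest G"
  obtains f where "inj_on f (set (labels F))" "G = relabel f F"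
  using assms by (auto simp: abs_eq_iff renumbering_def)

lemma abs_eq_empty_iff: "exotic F \<Longrightarrow> abs_exotic_forest F = empty_forest \<longleftrightarrow> F = []"
  by (auto simp: empty_forest_def abs_eq_iff renumbering_def relabel_def)

text \<open>Taking unions is a bijection from sets of components onto the sets of positions whose
  subsequence and complementary subsequence are exotic; the inverse takes the components contained
  in a given set. All other subsets contribute 0.\<close>

lemma sum_components:
  assumes "exotic F"
  shows "(\<Sum>S\<in>Pow (components F). f (nths F (\<Union>S)) (nths F (\<Union>(components F - S)))) =
    unshuffle F (\<lambda>A B. if exotic A \<and> exotic B then f A B else 0)"
proof -
  let ?n = "{..<length F}" and ?C = "components F"
  have part: "partition_on ?n ?C"
    by (rule partition_on_components[OF assms])
  have disj: "C = D" if "C \<in> ?C" "D \<in> ?C" "x \<in> C" "x \<in> D" for C D x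
    using partition_onD2[OF part] that by (auto simp: disjoint_def)
  have Un: "\<Union>?C = ?n" using partition_onD1[OF part] by simp
  have compl: "\<Union>(?C - S) = ?n - \<Union>S" if "S \<subseteq> ?C" for S
    using that disj unfolding Un[symmetric] by blast
  have exotic_Union: "exotic (nths F (\<Union>S))" if S: "S \<subseteq> ?C" for S
  proof -
    have sub: "\<Union>S \<subseteq> ?n" using S Un by blast
    \<comment> \<open>By \<open>exotic_nths_iff\<close>, a subsequence of an exotic forest is exotic
      when no integer occurs both inside and outside it. In this form the property passes to
      unions.\<close>
    have "\<forall>n. (\<forall>i\<in>C. n \<notin> set (tree_labels (F ! i))) \<or> (\<forall>i\<in>?n - C. n \<notin> set (tree_labels (F ! i)))"
      if "C \<in> S" for C
      using that S exotic_nths_iff[OF assms, of C] by (auto simp: components_def connected_in_def)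
    then show ?thesis unfolding exotic_nths_iff[OF assms sub] by blast
  qed
  \<comment> \<open>Each position of \<open>I\<close> lies in a connected subsequence that is still
    contained in \<open>I\<close>.\<close>
  have inv: "\<Union>{C \<in> ?C. C \<subseteq> I} = I" if "I \<subseteq> ?n" "exotic (nths F I)" for I
    using exotic_contains_connected[OF assms that] by (auto simp: components_def)
  have "{C \<in> ?C. C \<subseteq> \<Union>S} = S" if S: "S \<subseteq> ?C" for S
  proof
    show "{C \<in> ?C. C \<subseteq> \<Union>S} \<subseteq> S"
    proof
      fix C assume C: "C \<in> {C \<in> ?C. C \<subseteq> \<Union>S}"
      then obtain x where "x \<in> C" by (auto simp: components_def connected_in_def)
      then obtain D where "D \<in> S" "x \<in> D" using C by blast
      then show "C \<in> S" using disj[of C D x] C S \<open>x \<in> C\<close> by blast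
    qed
  qed (use S in blast)
  note inv' = this
  have "(\<Sum>S\<in>Pow ?C. f (nths F (\<Union>S)) (nths F (\<Union>(?C - S)))) =
    (\<Sum>I \<in> {I \<in> Pow ?n. exotic (nths F I) \<and> exotic (nths F (?n - I))}. f (nths F I) (nths F (?n - I)))"
  proof (rule sum.reindex_bij_witness[where j = Union and i = "\<lambda>I. {C \<in> ?C. C \<subseteq> I}"])
    fix S assume "S \<in> Pow ?C"
    then have S: "S \<subseteq> ?C" by simp
    show "{C \<in> ?C. C \<subseteq> \<Union>S} = S" by (rule inv'[OF S])
    show "\<Union>S \<in> {I \<in> Pow ?n. exotic (nths F I) \<and> exotic (nths F (?n - I))}"
    proof -
      have "\<Union>S \<subseteq> ?n" using S Un by blast
      then show ?thesis using exotic_Union[OF S] exotic_Union[of "?C - S"] compl[OF S] by simp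
    qed
    show "f (nths F (\<Union>S)) (nths F (?n - \<Union>S)) = f (nths F (\<Union>S)) (nths F (\<Union>(?C - S)))"
      by (simp only: compl[OF S])
  next
    fix I assume "I \<in> {I \<in> Pow ?n. exotic (nths F I) \<and> exotic (nths F (?n - I))}"
    then show "\<Union>{C \<in> ?C. C \<subseteq> I} = I" by (intro inv) auto
  qed auto
  also have "\<dots>
      = (\<Sum>I \<in> Pow ?n.
      if exotic (nths F I) \<and> exotic (nths F (?n - I)) then f (nths F I) (nths F (?n - I)) else 0)"
    by (rule sum.inter_filter) simp
  also have "\<dots> = unshuffle F (\<lambda>A B. if exotic A \<and> exotic B then f A B else 0)"
    by (rule sum_Pow_nths)
  finally show ?thesis .
qed

section \<open>Independence of the chosen representatives\<close>

lemma set_labels_union: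
  "mset (labels H) = mset (labels F) + mset (labels G) \<Longrightarrow> set (labels H)
      = set (labels F) \<union> set (labels G)"
  by (metis set_mset_mset set_mset_union)

lemma mset_set_labels:
  "mset A + mset B = mset F \<Longrightarrow> set (labels F) = set (labels A) \<union> set (labels B)"
  by (rule set_labels_union, rule mset_labels_split)

text \<open>The representative in the definition is a renumbering \<open>h\<close> of
  \<open>F\<close>. Being injective with positive values on the labels of \<open>F\<close>, it
  preserves exoticness and the class of every part of \<open>F\<close>.\<close>

lemma deshuffle_basis_abs:
  assumes "exotic F"
  shows "deshuffle_basis (abs_exotic_forest F) =
    unshuffle F (\<lambda>A B.
        if exotic A \<and> exotic B then basis (abs_exotic_forest A, abs_exotic_forest B) else 0)"
proof -
  let ?G = "rep_exotic_forest (abs_exotic_forest F)"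
  have G: "exotic ?G" by (rule exotic_rep)
  obtain h where h: "inj_on h (set (labels F))" "?G = relabel h F"
    using abs_relabelE[OF assms G] by auto
  have pos: "n > 0 \<and> h n > 0" if "n \<in> set (labels F)" for n
    using exotic_pos[OF assms that] exotic_pos[OF G, of "h n"] that by (simp add: h(2))
  have rel: "exotic (relabel h A) \<longleftrightarrow> exotic A"
    "exotic A \<Longrightarrow> abs_exotic_forest (relabel h A) = abs_exotic_forest A"
    if "set (labels A) \<subseteq> set (labels F)" for A
  proof -
    have "inj_on h (set (labels A))" using h(1) that by (rule inj_on_subset)
    then show "exotic (relabel h A) \<longleftrightarrow> exotic A" "exotic A \<Longrightarrow> abs_exotic_forest (relabel h A)
        = abs_exotic_forest A"
      using that pos by (blast intro!: exotic_relabel, blast intro!: abs_relabel)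
  qed
  have "deshuffle_basis (abs_exotic_forest F) = unshuffle ?G (\<lambda>A B. if exotic A \<and> exotic B
      then basis (abs_exotic_forest A, abs_exotic_forest B) else 0)"
    unfolding deshuffle_basis_def Let_def by (rule sum_components[OF G])
  also have "\<dots> = unshuffle F (\<lambda>A B. if exotic (relabel h A) \<and> exotic (relabel h B)
      then basis (abs_exotic_forest (relabel h A), abs_exotic_forest (relabel h B)) else 0)"
    unfolding h(2) relabel_def unshuffle_map ..
  also have "\<dots> = unshuffle F (\<lambda>A B. if exotic A \<and> exotic B
      then basis (abs_exotic_forest A, abs_exotic_forest B) else 0)"
  proof (rule unshuffle_cong)
    fix A B assume "mset A + mset B = mset F"
    then have "set (labels A) \<subseteq> set (labels F)" "set (labels B) \<subseteq> set (labels F)"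
      using mset_set_labels by blast+
    then show "(if exotic (relabel h A) \<and> exotic (relabel h B)
      then basis (abs_exotic_forest (relabel h A), abs_exotic_forest (relabel h B)) else 0) =
      (if exotic A \<and> exotic B then basis (abs_exotic_forest A, abs_exotic_forest B) else 0)"
      by (simp add: rel)
  qed
  finally show ?thesis .
qed

text \<open>Provides representatives with labels in a prescribed residue class, and thereby forests
  with disjoint labels.\<close>

lemma abs_relabel_rep:
  assumes "inj f" "\<And>n. n > 0 \<Longrightarrow> f n > 0"
  shows "abs_exotic_forest (relabel f (rep_exotic_forest \<pi>)) = \<pi>"
    and "exotic (relabel f (rep_exotic_forest \<pi>))"
proof -
  have inj: "inj_on f A" for A using assms(1) by (rule inj_on_subset) simp
  note pos = exotic_pos[OF exotic_rep[of \<pi>]]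
  show "abs_exotic_forest (relabel f (rep_exotic_forest \<pi>)) = \<pi>"
    using abs_relabel[OF exotic_rep inj] pos assms(2) by simp
  show "exotic (relabel f (rep_exotic_forest \<pi>))"
    using exotic_relabel[OF inj] exotic_rep pos assms(2) by blast
qed

lemma gl_basis_abs:
  assumes FG: "exotic F" "exotic G" and disj: "set (labels F) \<inter> set (labels G) = {}"
  shows "gl_basis (abs_exotic_forest F) (abs_exotic_forest G)
      = gl_sum F G (\<lambda>H. basis (abs_exotic_forest H))"
proof -
  let ?F = "relabel (\<lambda>n. 2 * n + 1) (rep_exotic_forest (abs_exotic_forest F))"
  let ?G = "relabel (\<lambda>n. 2 * n) (rep_exotic_forest (abs_exotic_forest G))"
  have F: "abs_exotic_forest ?F = abs_exotic_forest F" "exotic ?F"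
    by (rule abs_relabel_rep; simp add: inj_def)+
  have G: "abs_exotic_forest ?G = abs_exotic_forest G" "exotic ?G"
    by (rule abs_relabel_rep; simp add: inj_def)+
  obtain f where f: "inj_on f (set (labels F))" "?F = relabel f F"
    by (rule abs_relabelE[OF FG(1) F(2) F(1)[symmetric]])
  obtain g where g: "inj_on g (set (labels G))" "?G = relabel g G"
    by (rule abs_relabelE[OF FG(2) G(2) G(1)[symmetric]])
  \<comment> \<open>The two renumberings have to be glued into one that acts on the terms of the
    product. It is injective because its values are odd on the labels of \<open>F\<close> and even
    on those of \<open>G\<close>.\<close>
  define h where "h n = (if n \<in> set (labels F) then f n else g n)" for n
  have hF: "relabel h F = ?F" unfolding f(2) by (rule relabel_cong) (simp add: h_def)
  have hG: "relabel h G = ?G" unfolding g(2) by (rule relabel_cong) (use disj in \<open>auto simp: h_def\<close>)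
  have oddF: "odd (h n)" if "n \<in> set (labels F)" for n
  proof -
    have "h n \<in> set (labels ?F)" using that unfolding hF[symmetric] by simp
    then show ?thesis by auto
  qed
  have evenG: "even (h n)" if "n \<in> set (labels G)" for n
  proof -
    have "h n \<in> set (labels ?G)" using that unfolding hG[symmetric] by simp
    then show ?thesis by auto
  qed
  have pos: "h n > 0" if "n \<in> set (labels F) \<union> set (labels G)" for n
    using that exotic_pos[OF F(2), of "h n"] exotic_pos[OF G(2), of "h n"]
    unfolding hF[symmetric] hG[symmetric] by auto
  have injF: "inj_on h (set (labels F))"
    using f(1) inj_on_cong[of "set (labels F)" h f] by (simp add: h_def)
  have "h n = g n" if "n \<in> set (labels G)" for n
    using that disj by (auto simp: h_def)
  then have injG: "inj_on h (set (labels G))"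
    using g(1) inj_on_cong[of "set (labels G)" h g] by blast
  have "h m \<noteq> h n" if "m \<in> set (labels F)" "n \<in> set (labels G)" for m n
    using oddF[OF that(1)] evenG[OF that(2)] by metis
  then have inj: "inj_on h (set (labels F) \<union> set (labels G))"
    unfolding inj_on_Un using injF injG by blast
  have "gl_basis (abs_exotic_forest F) (abs_exotic_forest G)
      = gl_sum ?F ?G (\<lambda>H. basis (abs_exotic_forest H))"
    unfolding gl_basis_def Let_def by (rule sum_graft)
  also have "\<dots> = gl_sum F G (\<lambda>H. basis (abs_exotic_forest (relabel h H)))"
    unfolding hF[symmetric] hG[symmetric] by (rule gl_sum_relabel)
  also have "\<dots> = gl_sum F G (\<lambda>H. basis (abs_exotic_forest H))"
  proof (rule gl_sum_cong)
    fix H assume H: "mset (labels H) = mset (labels F) + mset (labels G)"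
    then have "exotic H" using exotic_mset_union[OF H disj] FG by blast
    moreover have "set (labels H) = set (labels F) \<union> set (labels G)"
      using H by (metis set_mset_mset set_mset_union)
    ultimately have "abs_exotic_forest (relabel h H) = abs_exotic_forest H"
      using inj pos by (intro abs_relabel) auto
    then show "basis (abs_exotic_forest (relabel h H)) = basis (abs_exotic_forest H)" by simp
  qed
  finally show ?thesis .
qed

section \<open>Multilinear maps on free modules\<close>

abbreviation lin :: "(('b \<Rightarrow>\<^sub>0 'k::field) \<Rightarrow> ('c \<Rightarrow>\<^sub>0 'k)) \<Rightarrow> bool" where
  "lin \<equiv> Vector_Spaces.linear scale scale"

lemma lin_iff: "lin L \<longleftrightarrow> (\<forall>x y. L (x + y) = L x + L y) \<and> (\<forall>c x. L (scale c x) = scale c (L x))"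
  by (simp add: Vector_Spaces.linear_iff vector_space_scale)

lemma linI:
  assumes "\<And>x y. L (x + y) = L x + L y" "\<And>c x. L (scale c x) = scale c (L x)"
  shows "lin L"
  using assms by (simp add: lin_iff)

lemma lin_add: "lin L \<Longrightarrow> L (x + y) = L x + L y"
  and lin_scale: "lin L \<Longrightarrow> L (scale c x) = scale c (L x)"
  by (simp_all add: lin_iff)

lemma scale_0 [simp]: "scale 0 x = 0" "scale c 0 = 0"
  and scale_1 [simp]: "scale 1 x = x"
  and scale_scale: "scale c (scale d x) = scale (c * d) x"
  and scale_add_right: "scale c (x + y) = scale c x + scale c y"
  and scale_add_left: "scale (c + d) x = scale c x + scale d x"
  by (auto intro!: poly_mapping_eqI simp: lookup_scale lookup_add algebra_simps)

lemma lin_0: "lin L \<Longrightarrow> L 0 = 0"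
  using lin_scale[of L 0 0] by simp

lemma lin_sum: "lin L \<Longrightarrow> L (\<Sum>i\<in>I. f i) = (\<Sum>i\<in>I. L (f i))"
  by (induction I rule: infinite_finite_induct) (simp_all add: lin_add[of L] lin_0[of L])

lemma lin_id: "lin id" "lin (\<lambda>x. x)"
  by (simp_all add: lin_iff)

lemma lin_compose: "lin L \<Longrightarrow> lin M \<Longrightarrow> lin (\<lambda>x. L (M x))"
  by (simp add: lin_iff)

text \<open>Allows \<open>p\<close>, \<open>q\<close> and \<open>p + q\<close> to be expanded over
  one common index set.\<close>

lemma lin_ext_superset:
  assumes "finite S" "Poly_Mapping.keys p \<subseteq> S"
  shows "lin_ext f p = (\<Sum>b\<in>S. scale (Poly_Mapping.lookup p b) (f b))"
  unfolding lin_ext_def by (rule sum.mono_neutral_left) (use assms in \<open>auto simp: in_keys_iff\<close>)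

lemma lin_lin_ext [simp]: "lin (lin_ext f)"
proof (rule linI)
  fix p q :: "'b \<Rightarrow>\<^sub>0 'a"
  let ?S = "Poly_Mapping.keys p \<union> Poly_Mapping.keys q"
  have "lin_ext f (p + q) = (\<Sum>b\<in>?S. scale (Poly_Mapping.lookup (p + q) b) (f b))"
    using keys_add[of p q] by (intro lin_ext_superset) auto
  also have "\<dots>
      = (\<Sum>b\<in>?S. scale (Poly_Mapping.lookup p b) (f b))
      + (\<Sum>b\<in>?S. scale (Poly_Mapping.lookup q b) (f b))"
    by (simp add: lookup_add scale_add_left sum.distrib)
  also have "\<dots> = lin_ext f p + lin_ext f q"
    by (simp add: lin_ext_superset[symmetric])
  finally show "lin_ext f (p + q) = lin_ext f p + lin_ext f q" .
next
  fix c :: 'a and p :: "'b \<Rightarrow>\<^sub>0 'a"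
  have "lin_ext f (scale c p)
      = (\<Sum>b\<in>Poly_Mapping.keys p. scale (Poly_Mapping.lookup (scale c p) b) (f b))"
    by (rule lin_ext_superset) (auto simp: in_keys_iff lookup_scale)
  then show "lin_ext f (scale c p) = scale c (lin_ext f p)"
    by (simp add: lin_ext_def lookup_scale scale_scale lin_sum[OF linI[of
        "scale c"]] scale_add_right mult.commute)
qed

lemma lin_ext_basis [simp]: "lin_ext f (basis b) = f b"
  by (simp add: lin_ext_def basis_def)

lemma lin_ext_cong:
  assumes "\<And>b. b \<in> Poly_Mapping.keys p \<Longrightarrow> f b = g b"
  shows "lin_ext f p = lin_ext g p"
  unfolding lin_ext_def by (rule sum.cong) (simp_all add: assms)

lemma lin_ext_id: "lin_ext basis p = p"
proof (rule poly_mapping_eqI)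
  fix b
  have "Poly_Mapping.lookup (\<Sum>a\<in>S. f a) b
      = (\<Sum>a\<in>S. Poly_Mapping.lookup (f a) b)" for S and f :: "'a \<Rightarrow> ('a \<Rightarrow>\<^sub>0 'b)"
    by (induction S rule: infinite_finite_induct) (simp_all add: lookup_add)
  then show "Poly_Mapping.lookup (lin_ext basis p) b = Poly_Mapping.lookup p b"
    by (simp add: lin_ext_def lookup_scale basis_def lookup_single when_def in_keys_iff
        if_distrib[of "\<lambda>x. _ * x"] cong: if_cong)
qed

lemma lin_apply_lin_ext: "lin L \<Longrightarrow> L (lin_ext f p) = lin_ext (\<lambda>b. L (f b)) p"
  by (simp add: lin_ext_def lin_sum[of L] lin_scale[of L])

lemma lin_eqI:
  assumes "lin L" "lin M" "\<And>b. L (basis b) = M (basis b)"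
  shows "L p = M p"
proof -
  have "L p = L (lin_ext basis p)" by (simp add: lin_ext_id)
  also have "\<dots> = lin_ext (\<lambda>b. M (basis b)) p" using assms(3)
      by (simp only: lin_apply_lin_ext[OF assms(1)])
  also have "\<dots> = M (lin_ext basis p)" by (simp only: lin_apply_lin_ext[OF assms(2)])
  finally show ?thesis by (simp add: lin_ext_id)
qed

lemma lin_lin_ext_param:
  assumes "\<And>b. lin (\<lambda>x. f x b)"
  shows "lin (\<lambda>x. lin_ext (f x) p)"
proof (rule linI)
  fix x y c
  show "lin_ext (f (x + y)) p = lin_ext (f x) p + lin_ext (f y) p"
    by (simp add: lin_ext_def lin_add[OF assms] scale_add_right sum.distrib)
  show "lin_ext (f (scale c x)) p = scale c (lin_ext (f x) p)"
    by (simp add: lin_ext_def lin_scale[OF assms] lin_sum[OF linI[of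
        "scale c"]] scale_add_right scale_scale mult.commute)
qed

lemma lin_bilin_ext:
  "lin (\<lambda>p. bilin_ext f p q)" "lin (bilin_ext f p)"
  unfolding bilin_ext_def by (rule lin_lin_ext, rule lin_lin_ext_param, rule lin_lin_ext)

lemma bilin_ext_basis [simp]: "bilin_ext f (basis a) (basis b) = f a b"
  by (simp add: bilin_ext_def)

section \<open>Bilinear maps and their values on pure tensors\<close>

definition bilin :: "(('a \<Rightarrow>\<^sub>0 'k::field) \<Rightarrow> ('b \<Rightarrow>\<^sub>0 'k) \<Rightarrow> ('c \<Rightarrow>\<^sub>0 'k)) \<Rightarrow> bool" where
  "bilin m \<longleftrightarrow> (\<forall>x. lin (m x)) \<and> (\<forall>y. lin (\<lambda>x. m x y))"

lemma bilin_lin: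
  assumes "bilin m"
  shows "lin (m x)" "lin (\<lambda>x. m x y)"
    and "lin L \<Longrightarrow> lin (\<lambda>z. m x (L z))" "lin M \<Longrightarrow> lin (\<lambda>z. m (M z) y)"
    and "lin K \<Longrightarrow> lin (\<lambda>z. K (m x z))" "lin K \<Longrightarrow> lin (\<lambda>z. K (m z y))"
  using assms by (auto simp: bilin_def lin_iff)

lemma bilin_eqI:
  assumes "bilin m" "bilin m'" "\<And>a b. m (basis a) (basis b) = m' (basis a) (basis b)"
  shows "m x y = m' x y"
proof -
  have "m (basis a) y = m' (basis a) y" for a
    by (rule lin_eqI[OF bilin_lin(1)[OF assms(1)] bilin_lin(1)[OF assms(2)] assms(3)])
  then show ?thesis
    by (rule lin_eqI[OF bilin_lin(2)[OF assms(1)] bilin_lin(2)[OF assms(2)]])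
qed

lemma bilin_bilin_ext [simp]: "bilin (bilin_ext f)"
  by (simp add: bilin_def lin_bilin_ext)

lemma bilin_tensor [simp]: "bilin tensor"
  by (simp add: tensor_def)

lemma bilin_compose:
  assumes "bilin m"
  shows "lin L \<Longrightarrow> bilin (\<lambda>x y. L (m x y))"
    and "lin L' \<Longrightarrow> lin M \<Longrightarrow> bilin (\<lambda>x y. m (L' x) (M y))"
  using assms by (auto simp: bilin_def lin_iff)

lemma bilinI: "(\<And>x. lin (m x)) \<Longrightarrow> (\<And>y. lin (\<lambda>x. m x y)) \<Longrightarrow> bilin m"
  by (simp add: bilin_def)

lemma tensor_basis [simp]: "tensor (basis a) (basis b) = basis (a, b)"
  by (simp add: tensor_def)

lemma lin_tensor_map [simp]: "lin (tensor_map f g)"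
  by (simp add: tensor_map_def)

lemma tensor_map_tensor:
  assumes "lin f" "lin g"
  shows "tensor_map f g (tensor x y) = tensor (f x) (g y)"
proof (rule bilin_eqI[of "\<lambda>x y. tensor_map f g (tensor x y)"])
  show "bilin (\<lambda>x y. tensor_map f g (tensor x y))"
    by (rule bilin_compose(1)) simp_all
  show "bilin (\<lambda>x y. tensor (f x) (g y))"
    by (rule bilin_compose(2)[OF bilin_tensor assms])
qed (simp add: tensor_map_def)

lemma lin_mult_map [simp]: "lin (mult_map m)"
  by (simp add: mult_map_def)

lemma mult_map_tensor:
  assumes "bilin m"
  shows "mult_map m (tensor x y) = m x y"
proof (rule bilin_eqI[of "\<lambda>x y. mult_map m (tensor x y)"])
  show "bilin (\<lambda>x y. mult_map m (tensor x y))"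
    by (rule bilin_compose(1)) simp_all
qed (simp_all add: assms mult_map_def)

lemma lin_tensor_assoc [simp]: "lin tensor_assoc"
  by (simp add: tensor_assoc_def)

lemma tensor_assoc_tensor: "tensor_assoc (tensor (tensor x y) z) = tensor x (tensor y z)"
proof -
  have "tensor_assoc (tensor (tensor x y) (basis c)) = tensor x (tensor y (basis c))" for c
  proof (rule bilin_eqI[of "\<lambda>x y. tensor_assoc (tensor (tensor x y) (basis c))"])
    show "bilin (\<lambda>x y. tensor_assoc (tensor (tensor x y) (basis c)))"
      by (rule bilin_compose(1)[OF bilin_tensor bilin_lin(6)[OF bilin_tensor lin_tensor_assoc]])
    show "bilin (\<lambda>x y. tensor x (tensor y (basis c)))"
      by (rule bilin_compose(2)[OF bilin_tensor lin_id(2) bilin_lin(2)[OF bilin_tensor]])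
  qed (simp add: tensor_assoc_def)
  note basis = this
  show ?thesis
  proof (rule lin_eqI[of "\<lambda>z. tensor_assoc (tensor (tensor x y) z)"])
    show "lin (\<lambda>z. tensor_assoc (tensor (tensor x y) z))"
      by (rule bilin_lin(5)[OF bilin_tensor lin_tensor_assoc])
    show "lin (\<lambda>z. tensor x (tensor y z))"
      by (rule bilin_lin(3)[OF bilin_tensor bilin_lin(1)[OF bilin_tensor]])
  qed (rule basis)
qed

lemma bilin_tensor_mult [simp]: "bilin (tensor_mult m)"
  by (simp add: tensor_mult_def)

lemma tensor_mult_tensor:
  assumes m: "bilin m"
  shows "tensor_mult m (tensor a b) (tensor c d) = tensor (m a c) (m b d)"
proof -
  have basis: "tensor_mult m (tensor (basis a) (basis b)) (tensor c d)
      = tensor (m (basis a) c) (m (basis b) d)" for a b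
  proof (rule bilin_eqI[of "\<lambda>c d. tensor_mult m (tensor (basis a) (basis b)) (tensor c d)"])
    show "bilin (\<lambda>c d. tensor_mult m (tensor (basis a) (basis b)) (tensor c d))"
      by (rule bilin_compose(1)[OF bilin_tensor bilin_lin(1)[OF bilin_tensor_mult]])
    show "bilin (\<lambda>c d. tensor (m (basis a) c) (m (basis b) d))"
      by (rule bilin_compose(2)[OF bilin_tensor bilin_lin(1)[OF m] bilin_lin(1)[OF m]])
  qed (simp add: tensor_mult_def)
  show ?thesis
  proof (rule bilin_eqI[of "\<lambda>a b. tensor_mult m (tensor a b) (tensor c d)"])
    show "bilin (\<lambda>a b. tensor_mult m (tensor a b) (tensor c d))"
      by (rule bilin_compose(1)[OF bilin_tensor bilin_lin(2)[OF bilin_tensor_mult]])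
    show "bilin (\<lambda>a b. tensor (m a c) (m b d))"
      by (rule bilin_compose(2)[OF bilin_tensor bilin_lin(2)[OF m] bilin_lin(2)[OF m]])
  qed (rule basis)
qed

section \<open>Antipodes of conilpotent bialgebras\<close>

context bialgebra
begin

lemma bilin_mult: "bilin mult"
  by (rule bilinI) (rule linear_mult_right, rule linear_mult_left)

definition convolution ::
  "(('b \<Rightarrow>\<^sub>0 'k) \<Rightarrow> ('b \<Rightarrow>\<^sub>0 'k)) \<Rightarrow> (('b \<Rightarrow>\<^sub>0 'k) \<Rightarrow> ('b \<Rightarrow>\<^sub>0 'k)) \<Rightarrow> ('b \<Rightarrow>\<^sub>0 'k) \<Rightarrow> ('b \<Rightarrow>\<^sub>0 'k)" where
  "convolution f g x = mult_map mult (tensor_map f g (comult x))"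

definition conv_unit :: "('b \<Rightarrow>\<^sub>0 'k) \<Rightarrow> ('b \<Rightarrow>\<^sub>0 'k)" where
  "conv_unit x = scale (counit x) unit"

lemma counit_add: "counit (x + y) = counit x + counit y"
  and counit_scale: "counit (scale c x) = c * counit x"
  using linear_counit by (simp_all add: Vector_Spaces.linear_iff)

lemma lin_conv_unit: "lin conv_unit"
  by (rule linI) (simp_all add: conv_unit_def counit_add counit_scale scale_add_left scale_scale)

lemma lin_convolution: "lin (convolution f g)"
  unfolding convolution_def[abs_def]
  by (rule lin_compose[OF lin_mult_map lin_compose[OF lin_tensor_map linear_comult]])

lemma mult_tensor_map_tensor:
  assumes "lin f" "lin g"
  shows "mult_map mult (tensor_map f g (tensor x y)) = mult (f x) (g y)"
  by (simp add: tensor_map_tensor[OF assms] mult_map_tensor[OF bilin_mult])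

lemma lin_mult_tensor_map: "lin (\<lambda>z. mult_map mult (tensor_map f g z))"
  by (rule lin_compose[OF lin_mult_map lin_tensor_map])

lemma convolution_assoc:
  assumes f: "lin f" and g: "lin g" and h: "lin h"
  shows "convolution (convolution f g) h = convolution f (convolution g h)"
proof
  fix x
  \<comment> \<open>\<open>T\<close> is the triple product on the threefold tensor power. Both sides
    are \<open>T\<close> applied to one of the two iterated coproducts, and coassociativity
    identifies these.\<close>
  define T where "T = lin_ext (\<lambda>(a, b, c). mult (mult (f (basis a)) (g (basis b))) (h (basis c)))"
  have T: "lin T" by (simp add: T_def)
  have left: "mult (mult_map mult (tensor_map f g z)) (h (basis c))
      = T (tensor_assoc (tensor z (basis c)))" for z c
  proof (rule lin_eqI[of "\<lambda>z. mult (mult_map mult (tensor_map f g z)) (h (basis c))"])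
    show "lin (\<lambda>z. mult (mult_map mult (tensor_map f g z)) (h (basis c)))"
      by (rule bilin_lin(4)[OF bilin_mult lin_mult_tensor_map])
    show "lin (\<lambda>z. T (tensor_assoc (tensor z (basis c))))"
      by (rule bilin_lin(6)[OF bilin_tensor lin_compose[OF T lin_tensor_assoc]])
    fix p
    show "mult (mult_map mult (tensor_map f g (basis p))) (h (basis c))
        = T (tensor_assoc (tensor (basis p) (basis c)))"
      by (cases p) (simp add: tensor_basis[symmetric] mult_tensor_map_tensor[OF f g]
          tensor_assoc_tensor del: tensor_basis,
        simp add: T_def)
  qed
  have right: "mult (f (basis a)) (mult_map mult (tensor_map g h z))
      = T (tensor (basis a) z)" for z a
  proof (rule lin_eqI[of "\<lambda>z. mult (f (basis a)) (mult_map mult (tensor_map g h z))"])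
    show "lin (\<lambda>z. mult (f (basis a)) (mult_map mult (tensor_map g h z)))"
      by (rule bilin_lin(3)[OF bilin_mult lin_mult_tensor_map])
    show "lin (\<lambda>z. T (tensor (basis a) z))"
      by (rule bilin_lin(5)[OF bilin_tensor T])
    fix p
    show "mult (f (basis a)) (mult_map mult (tensor_map g h (basis p)))
        = T (tensor (basis a) (basis p))"
      by (cases p) (simp add: tensor_basis[symmetric] mult_tensor_map_tensor[OF g h] del:
          tensor_basis,
        simp add: T_def mult_assoc)
  qed
  have "mult_map mult (tensor_map (convolution f g) h y)
      = T (tensor_assoc (tensor_map comult id y))" for y
  proof (rule lin_eqI[OF lin_mult_tensor_map])
    show "lin (\<lambda>y. T (tensor_assoc (tensor_map comult id y)))"
      by (rule lin_compose[OF T lin_compose[OF lin_tensor_assoc lin_tensor_map]])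
    fix p :: "'b \<times> 'b"
    obtain a b where p: "basis p = (tensor (basis a) (basis b) :: _ \<Rightarrow>\<^sub>0 'k)" by (cases p) simp
    show "mult_map mult (tensor_map (convolution f g) h (basis p))
        = T (tensor_assoc (tensor_map comult id (basis p)))"
      unfolding p mult_tensor_map_tensor[OF lin_convolution h]
          tensor_map_tensor[OF linear_comult lin_id(1)]
      by (simp add: convolution_def left)
  qed
  moreover have "mult_map mult (tensor_map f (convolution g h) y)
      = T (tensor_map id comult y)" for y
  proof (rule lin_eqI[OF lin_mult_tensor_map])
    show "lin (\<lambda>y. T (tensor_map id comult y))"
      by (rule lin_compose[OF T lin_tensor_map])
    fix p :: "'b \<times> 'b"
    obtain a b where p: "basis p = (tensor (basis a) (basis b) :: _ \<Rightarrow>\<^sub>0 'k)" by (cases p) simp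
    show "mult_map mult (tensor_map f (convolution g h) (basis p))
        = T (tensor_map id comult (basis p))"
      unfolding p mult_tensor_map_tensor[OF f lin_convolution]
          tensor_map_tensor[OF lin_id(1) linear_comult]
      by (simp add: convolution_def right)
  qed
  ultimately show "convolution (convolution f g) h x = convolution f (convolution g h) x"
    by (simp add: convolution_def[of "convolution f g"] convolution_def[of f
        "convolution g h"] coassoc)
qed

lemma convolution_unit:
  assumes f: "lin f"
  shows "convolution conv_unit f = f" "convolution f conv_unit = f"
proof -
  have "mult_map mult (tensor_map conv_unit f y)
      = f (lin_ext (\<lambda>(a, b). scale (counit (basis a)) (basis b)) y)" for y
  proof (rule lin_eqI[OF lin_mult_tensor_map lin_compose[OF f lin_lin_ext]])
    fix p :: "'b \<times> 'b"
    obtain a b where p: "p = (a, b)" by (cases p)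
    show "mult_map mult (tensor_map conv_unit f (basis p))
        = f (lin_ext (\<lambda>(a, b). scale (counit (basis a)) (basis b)) (basis p))"
      unfolding p lin_ext_basis tensor_basis[symmetric] mult_tensor_map_tensor[OF lin_conv_unit f]
      by (simp add: conv_unit_def lin_scale[OF f] lin_scale[OF bilin_lin(2)[OF bilin_mult]] mult_unit_left)
  qed
  then show "convolution conv_unit f = f"
    by (simp add: fun_eq_iff convolution_def counit_left)
  have "mult_map mult (tensor_map f conv_unit y)
      = f (lin_ext (\<lambda>(a, b). scale (counit (basis b)) (basis a)) y)" for y
  proof (rule lin_eqI[OF lin_mult_tensor_map lin_compose[OF f lin_lin_ext]])
    fix p :: "'b \<times> 'b"
    obtain a b where p: "p = (a, b)" by (cases p)
    show "mult_map mult (tensor_map f conv_unit (basis p))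
        = f (lin_ext (\<lambda>(a, b). scale (counit (basis b)) (basis a)) (basis p))"
      unfolding p lin_ext_basis tensor_basis[symmetric] mult_tensor_map_tensor[OF f lin_conv_unit]
      by (simp add: conv_unit_def lin_scale[OF f] lin_scale[OF bilin_lin(1)[OF bilin_mult]] mult_unit_right)
  qed
  then show "convolution f conv_unit = f"
    by (simp add: fun_eq_iff convolution_def counit_right)
qed

text \<open>Off the unit, the equation for \<open>g\<close> on \<open>b\<close> reads:
  \<open>g\<close> at \<open>b\<close>, plus products of \<open>f\<close> with values of
  \<open>g\<close> at basis elements of smaller size, equals 0. It can be solved by recursion on the
  size.\<close>

lemma left_convolution_inverse:
  fixes size :: "'b \<Rightarrow> nat"
  assumes unit: "unit = basis e" and counit: "\<And>b. b \<noteq> e \<Longrightarrow> counit (basis b) = 0"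
    and conil: "\<And>b. \<exists>R. comult (basis b)
        = tensor (basis b) unit + R \<and> (\<forall>(c, d) \<in> Poly_Mapping.keys R. size c < size b)"
    and f: "lin f" "f unit = unit"
  shows "\<exists>g. lin g \<and> g unit = unit \<and> convolution g f = conv_unit"
proof -
  obtain R where R: "\<And>b. comult (basis b) = tensor (basis b) unit + R b"
    and small: "\<And>b c d. (c, d) \<in> Poly_Mapping.keys (R b) \<Longrightarrow> size c < size b"
    using conil by (metis (mono_tags, lifting) case_prodD)
  \<comment> \<open>The equation solved for the leading term, which is multiplied by
    \<open>f unit = unit\<close>.\<close>
  define K where "K G b = (if b
      = e then unit else - lin_ext (\<lambda>(c, d). mult (G c) (f (basis d))) (R b))" for G b
  define G where "G = wfrec (measure size) K"
  have "G b = K (cut G (measure size) b) b" for b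
    unfolding G_def by (rule wfrec) simp
  \<comment> \<open>The left tensor factors in \<open>R b\<close> are all smaller than
    \<open>b\<close>, so the restriction by \<open>cut\<close> changes nothing.\<close>
  moreover have "lin_ext (\<lambda>(c, d). mult (cut G (measure size) b c) (f (basis d))) (R b)
      = lin_ext (\<lambda>(c, d). mult (G c) (f (basis d))) (R b)" for b
    by (rule lin_ext_cong) (auto simp: cut_def dest: small)
  ultimately have G: "G b = K G b" for b
    by (simp add: K_def)
  define g where "g = lin_ext G"
  have g: "lin g" "g unit = unit"
    using G[of e] by (simp_all add: g_def unit K_def)
  have "convolution g f (basis b) = conv_unit (basis b)" for b
  proof (cases "b = e")
    case True
    then show ?thesis
      using f g counit_unit
      by (simp only: convolution_def conv_unit_def unit[symmetric] comult_unit mult_tensor_map_tensor[OF g(1) f(1)] mult_unit_left scale_1)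
  next
    case False
    have "mult_map mult (tensor_map g f y) = lin_ext (\<lambda>(c, d). mult (G c) (f (basis d))) y" for y
    proof (rule lin_eqI[OF lin_mult_tensor_map lin_lin_ext])
      fix p :: "'b \<times> 'b"
      obtain c d where p: "p = (c, d)" by (cases p)
      show "mult_map mult (tensor_map g f (basis p))
          = lin_ext (\<lambda>(c, d). mult (G c) (f (basis d))) (basis p)"
        unfolding p lin_ext_basis tensor_basis[symmetric] mult_tensor_map_tensor[OF g(1) f(1)]
        by (simp add: g_def)
    qed
    then have "convolution g f (basis b)
        = mult (g (basis b)) (f unit) + lin_ext (\<lambda>(c, d). mult (G c) (f (basis d))) (R b)"
      unfolding convolution_def R lin_add[OF lin_mult_tensor_map] mult_tensor_map_tensor[OF g(1) f(1)] by simp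
    also have "\<dots> = G b + lin_ext (\<lambda>(c, d). mult (G c) (f (basis d))) (R b)"
      by (simp add: f(2) mult_unit_right g_def)
    also have "\<dots> = 0"
      using G[of b] False by (simp add: K_def)
    finally show ?thesis using counit[OF False] by (simp add: conv_unit_def)
  qed
  then have "convolution g f = conv_unit"
    using lin_eqI[OF lin_convolution lin_conv_unit] by blast
  then show ?thesis using g by blast
qed

text \<open>The left inverse \<open>S\<close> of the identity has a left inverse itself, which must then be the identity; so
  \<open>S\<close> is two-sided.\<close>

theorem hopf_algebra_if_conilpotent:
  fixes size :: "'b \<Rightarrow> nat"
  assumes unit: "unit = basis e" and counit: "\<And>b. b \<noteq> e \<Longrightarrow> counit (basis b) = 0"
    and conil: "\<And>b. \<exists>R. comult (basis b)
        = tensor (basis b) unit + R \<and> (\<forall>(c, d) \<in> Poly_Mapping.keys R. size c < size b)"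
  shows "\<exists>antipode. hopf_algebra mult unit comult counit antipode"
proof -
  have inverse: "\<exists>g. lin g \<and> g unit = unit \<and> convolution g f = conv_unit"
    if "lin f" "f unit = unit" for f
    by (rule left_convolution_inverse[OF unit counit conil that])
  obtain S where S: "lin S" "S unit = unit" "convolution S id = conv_unit"
    using inverse[OF lin_id(1)] by auto
  obtain T where T: "lin T" "convolution T S = conv_unit"
    using inverse[OF S(1,2)] by blast
  have "T = convolution T (convolution S id)"
    unfolding S(3) by (rule convolution_unit(2)[OF T(1), symmetric])
  also have "\<dots> = convolution (convolution T S) id"
    by (rule convolution_assoc[OF T(1) S(1) lin_id(1), symmetric])
  also have "\<dots> = id"
    unfolding T(2) by (rule convolution_unit(1)[OF lin_id(1)])
  finally have "convolution id S = conv_unit" using T(2) by simp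
  then have "hopf_algebra mult unit comult counit S"
    using S by (intro hopf_algebra.intro hopf_algebra_axioms.intro bialgebra_axioms)
      (simp_all add: fun_eq_iff convolution_def conv_unit_def)
  then show ?thesis by blast
qed

end

section \<open>The Hopf algebra of exotic forests\<close>

text \<open>Sending non-exotic forests to \<open>0\<close> turns the sum over exotic subsequences into a sum over all of them.\<close>

definition forest_vec :: "nat forest \<Rightarrow> (exotic_forest \<Rightarrow>\<^sub>0 'k::field)" where
  "forest_vec F = (if exotic F then basis (abs_exotic_forest F) else 0)"

lemma forest_vec_rep: "basis \<pi> = forest_vec (rep_exotic_forest \<pi>)"
  by (simp add: forest_vec_def exotic_rep)

lemma basis_empty_forest: "basis empty_forest = forest_vec []"
  by (simp add: forest_vec_def empty_forest_def)

lemma bilin_gl_product: "bilin gl_product"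
  by (simp add: gl_product_def)

lemma lin_deshuffle: "lin deshuffle"
  by (simp add: deshuffle_def)

lemma lin_gl_sum: "lin L \<Longrightarrow> L (gl_sum F G f) = gl_sum F G (\<lambda>H. L (f H))"
  by (rule gl_sum_hom) (simp_all add: lin_add lin_0)

lemma lin_unshuffle: "lin L \<Longrightarrow> L (unshuffle F f) = unshuffle F (\<lambda>A B. L (f A B))"
  by (rule unshuffle_hom) (rule lin_add)

lemma bilin_0: "bilin m \<Longrightarrow> m 0 y = 0" "bilin m \<Longrightarrow> m x 0 = 0"
  using lin_0[OF bilin_lin(1)] lin_0[OF bilin_lin(2)] by blast+

text \<open>If a factor is not exotic, then no term is, and both sides vanish. So the formula also
  applies to the possibly non-exotic parts in an unshuffling.\<close>

lemma gl_product_forest_vec: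
  assumes disj: "set (labels F) \<inter> set (labels G) = {}"
  shows "gl_product (forest_vec F) (forest_vec G) = (gl_sum F G forest_vec :: _ \<Rightarrow>\<^sub>0 'k::field)"
proof (cases "exotic F \<and> exotic G")
  case True
  then have "gl_product (forest_vec F) (forest_vec G)
      = gl_sum F G (\<lambda>H. basis (abs_exotic_forest H))"
    by (simp add: forest_vec_def gl_product_def gl_basis_abs disj)
  also have "\<dots> = gl_sum F G forest_vec"
    by (rule gl_sum_cong) (simp add: forest_vec_def exotic_mset_union[OF _ disj] True)
  finally show ?thesis .
next
  case False
  have "gl_sum F G forest_vec = gl_sum F G (\<lambda>_. 0 :: _ \<Rightarrow>\<^sub>0 'k)"
    by (rule gl_sum_cong) (use False in \<open>auto simp: forest_vec_def exotic_mset_union[OF _ disj]\<close>)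
  moreover have "gl_product (forest_vec F) (forest_vec G) = (0 :: _ \<Rightarrow>\<^sub>0 'k)"
    using False by (auto simp: forest_vec_def bilin_0[OF bilin_gl_product])
  ultimately show ?thesis by simp
qed

lemma deshuffle_forest_vec_exotic:
  assumes "exotic F"
  shows "deshuffle (forest_vec F) = unshuffle F (\<lambda>A B. tensor (forest_vec A) (forest_vec B))"
proof -
  have "deshuffle (forest_vec F) = deshuffle_basis (abs_exotic_forest F)"
    by (simp add: assms forest_vec_def deshuffle_def)
  also have "\<dots> = unshuffle F (\<lambda>A B. tensor (forest_vec A) (forest_vec B))"
    unfolding deshuffle_basis_abs[OF assms]
    by (rule unshuffle_cong) (simp add: forest_vec_def bilin_0[OF bilin_tensor])
  finally show ?thesis .
qed

text \<open>For a non-exotic \<open>F\<close> the formula can fail, as two exotic parts may use the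
  same integer. This is excluded when the labels of \<open>F\<close> are part of those of an exotic
  \<open>G\<close>: an exotic part then has labels disjoint from all the rest, and two exotic parts
  would make \<open>F\<close> exotic.\<close>

lemma deshuffle_forest_vec:
  assumes G: "exotic G" and split: "mset (labels G) = mset (labels F) + mset (labels R)"
  shows "deshuffle (forest_vec F) = unshuffle F (\<lambda>A B. tensor (forest_vec A) (forest_vec B))"
proof (cases "exotic F")
  case False
  have "\<not> (exotic A \<and> exotic B)" if "mset A + mset B = mset F" for A B
  proof
    assume AB: "exotic A \<and> exotic B"
    have F: "mset (labels F) = mset (labels A) + mset (labels B)"
      using that by (rule mset_labels_split)
    have "mset (labels G) = mset (labels A) + mset (labels (B @ R))"
      using split F by simp
    then have "set (labels A) \<inter> set (labels (B @ R)) = {}"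
      using exotic_split_disjoint[OF G] AB by blast
    then show False
      using exotic_mset_union[OF F] AB False by auto
  qed
  then have "unshuffle F (\<lambda>A B. tensor (forest_vec A) (forest_vec B)) = unshuffle F (\<lambda>A B. 0)"
    by (intro unshuffle_cong) (auto simp: forest_vec_def bilin_0[OF bilin_tensor])
  then show ?thesis using False by (simp add: forest_vec_def lin_0[OF lin_deshuffle])
qed (rule deshuffle_forest_vec_exotic)

text \<open>The labels of the three representatives are moved into the three residue classes modulo
  3.\<close>

lemma obtain_disjoint_forests:
  obtains F G K where "exotic F" "exotic G" "exotic K"
    and "set (labels F) \<inter> set (labels G) = {}" "set (labels F) \<inter> set (labels K) = {}"
      "set (labels G) \<inter> set (labels K) = {}"
    and "basis \<pi> = forest_vec F" "basis \<eta> = forest_vec G" "basis \<zeta> = forest_vec K"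
proof
  let ?r = "\<lambda>i \<pi>. relabel (\<lambda>n. 3 * n + i) (rep_exotic_forest \<pi>)"
  have r: "abs_exotic_forest (?r i \<pi>) = \<pi>" "exotic (?r i \<pi>)" for i \<pi>
    by (rule abs_relabel_rep; simp add: inj_def)+
  show "exotic (?r 0 \<pi>)" "exotic (?r 1 \<eta>)" "exotic (?r 2 \<zeta>)" by (rule r)+
  show "set (labels (?r 0 \<pi>)) \<inter> set (labels (?r 1 \<eta>))
      = {}" "set (labels (?r 0 \<pi>)) \<inter> set (labels (?r 2 \<zeta>)) = {}"
    "set (labels (?r 1 \<eta>)) \<inter> set (labels (?r 2 \<zeta>)) = {}"
    by (auto, presburger+)
  show "basis \<pi> = forest_vec (?r 0 \<pi>)" "basis \<eta> = forest_vec (?r 1 \<eta>)" "basis \<zeta>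
      = forest_vec (?r 2 \<zeta>)"
    by (simp_all only: forest_vec_def r if_True)
qed

section \<open>Associativity, compatibility and coassociativity\<close>

lemma gl_product_assoc:
  "gl_product (gl_product x y) z = (gl_product x (gl_product y z) :: _ \<Rightarrow>\<^sub>0 'k::field)"
proof -
  note gl = bilin_lin[OF bilin_gl_product]
  have basis: "gl_product (gl_product (basis \<pi>) (basis \<eta>)) (basis \<zeta>) =
     (gl_product (basis \<pi>) (gl_product (basis \<eta>) (basis \<zeta>)) :: _ \<Rightarrow>\<^sub>0 'k)" for \<pi> \<eta> \<zeta>
  proof -
    obtain F G K where disj: "set (labels F) \<inter> set (labels G)
        = {}" "set (labels F) \<inter> set (labels K) = {}"
      "set (labels G) \<inter> set (labels K) = {}"
      and b: "basis \<pi> = (forest_vec F :: _ \<Rightarrow>\<^sub>0 'k)" "basis \<eta> = (forest_vec G :: _ \<Rightarrow>\<^sub>0 'k)"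
        "basis \<zeta> = (forest_vec K :: _ \<Rightarrow>\<^sub>0 'k)"
      by (rule obtain_disjoint_forests)
    have "gl_product (gl_product (basis \<pi>) (basis \<eta>)) (basis \<zeta>)
        = gl_sum F G (\<lambda>H. gl_product (forest_vec H) (forest_vec K :: _ \<Rightarrow>\<^sub>0 'k))"
      unfolding b gl_product_forest_vec[OF disj(1)] by (rule lin_gl_sum[OF gl(2)])
    \<comment> \<open>A term \<open>H\<close> has the labels of \<open>F\<close> and
      \<open>G\<close>, so they are still disjoint from those of \<open>K\<close>.\<close>
    also have "\<dots> = gl_sum F G (\<lambda>H. gl_sum H K forest_vec)"
      by (rule gl_sum_cong, rule gl_product_forest_vec, drule set_labels_union) (use disj in blast)
    also have "\<dots> = gl_sum G K (\<lambda>H. gl_sum F H forest_vec)"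
      by (rule gl_sum_assoc[symmetric])
    also have "\<dots> = gl_sum G K (\<lambda>H. gl_product (forest_vec F) (forest_vec H))"
      by (rule gl_sum_cong, rule gl_product_forest_vec[symmetric], drule set_labels_union) (use disj in blast)
    also have "\<dots> = gl_product (basis \<pi>) (gl_product (basis \<eta>) (basis \<zeta>))"
      unfolding b gl_product_forest_vec[OF disj(3)] by (rule lin_gl_sum[OF gl(1), symmetric])
    finally show ?thesis .
  qed
  have "gl_product (gl_product x y) (basis \<zeta>) = gl_product x (gl_product y (basis \<zeta>))" for \<zeta>
    by (rule bilin_eqI[of "\<lambda>x y. gl_product (gl_product x y) (basis \<zeta>)"
        "\<lambda>x y. gl_product x (gl_product y (basis \<zeta>))"])
      (rule bilin_compose(1)[OF bilin_gl_product gl(2)] bilin_compose(2)[OF bilin_gl_product lin_id(2) gl(2)] basis)+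
  then show ?thesis
    by (rule lin_eqI[OF gl(1) gl(3)[OF gl(1)]])
qed

lemma comult_gl_product_basis:
  "deshuffle (gl_product (basis \<pi>) (basis \<eta>)) =
    (tensor_mult gl_product (deshuffle (basis \<pi>)) (deshuffle (basis \<eta>)) :: _ \<Rightarrow>\<^sub>0 'k::field)"
proof -
  note gl = bilin_lin[OF bilin_gl_product]
  let ?v = "forest_vec :: _ \<Rightarrow> _ \<Rightarrow>\<^sub>0 'k"
  let ?t = "\<lambda>A B. tensor (?v A) (?v B)"
  obtain F G K where ex: "exotic F" "exotic G" and disj: "set (labels F) \<inter> set (labels G) = {}"
    and b: "basis \<pi> = ?v F" "basis \<eta> = ?v G" "basis \<eta> = ?v K"
    by (rule obtain_disjoint_forests[of \<pi> \<eta> \<eta>])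
  have "deshuffle (gl_product (basis \<pi>) (basis \<eta>)) = gl_sum F G (\<lambda>H. deshuffle (?v H))"
    unfolding b(1,2) gl_product_forest_vec[OF disj] by (rule lin_gl_sum[OF lin_deshuffle])
  also have "\<dots> = gl_sum F G (\<lambda>H. unshuffle H ?t)"
    by (rule gl_sum_cong, rule deshuffle_forest_vec_exotic) (use exotic_mset_union[OF _ disj] ex in blast)
  also have "\<dots> = unshuffle F (\<lambda>A B. unshuffle G (\<lambda>C D. gl_sum A C (\<lambda>X. gl_sum B D (\<lambda>Y. ?t X Y))))"
    by (rule gl_sum_coprod)
  also have "\<dots> = unshuffle F (\<lambda>A B. unshuffle G (\<lambda>C D. tensor (gl_sum A C ?v) (gl_sum B D ?v)))"
    by (simp only: lin_gl_sum[OF bilin_lin(2)[OF bilin_tensor]],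
      simp only: lin_gl_sum[OF bilin_lin(1)[OF bilin_tensor]])
  also have "\<dots>
      = unshuffle F (\<lambda>A B. unshuffle G (\<lambda>C D.
      tensor (gl_product (?v A) (?v C)) (gl_product (?v B) (?v D))))"
  \<comment> \<open>The parts need not be exotic, but their labels inherit disjointness from
    \<open>F\<close> and \<open>G\<close>.\<close>
  proof (intro unshuffle_cong)
    fix A B C D assume "mset A + mset B = mset F" "mset C + mset D = mset G"
    then have "set (labels A) \<inter> set (labels C) = {}" "set (labels B) \<inter> set (labels D) = {}"
      using disj mset_set_labels[of A B F] mset_set_labels[of C D G] by blast+
    then show "tensor (gl_sum A C ?v) (gl_sum B D ?v)
        = tensor (gl_product (?v A) (?v C)) (gl_product (?v B) (?v D))"
      by (simp only: gl_product_forest_vec)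
  qed
  also have "\<dots> = tensor_mult gl_product (unshuffle F ?t) (unshuffle G ?t)"
    by (simp only: lin_unshuffle[OF bilin_lin(2)[OF bilin_tensor_mult]],
      simp only: lin_unshuffle[OF bilin_lin(1)[OF bilin_tensor_mult]]
          tensor_mult_tensor[OF bilin_gl_product])
  also have "\<dots> = tensor_mult gl_product (deshuffle (basis \<pi>)) (deshuffle (basis \<eta>))"
    unfolding b(1,2) by (simp only: deshuffle_forest_vec_exotic ex)
  finally show ?thesis .
qed

lemma coassoc_deshuffle_basis:
  "tensor_assoc (tensor_map deshuffle id (deshuffle (basis \<pi>))) =
    (tensor_map id deshuffle (deshuffle (basis \<pi>)) :: _ \<Rightarrow>\<^sub>0 'k::field)"
proof -
  let ?v = "forest_vec :: _ \<Rightarrow> _ \<Rightarrow>\<^sub>0 'k"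
  let ?t = "\<lambda>A B. tensor (?v A) (?v B)"
  let ?F = "rep_exotic_forest \<pi>"
  have \<Delta>: "deshuffle (basis \<pi>) = unshuffle ?F ?t"
    unfolding forest_vec_rep by (rule deshuffle_forest_vec_exotic[OF exotic_rep])
  \<comment> \<open>\<open>A\<close> may fail to be exotic, but it is part of an exotic forest, with
    \<open>B\<close> carrying the remaining labels.\<close>
  have \<Delta>A: "deshuffle (?v A) = unshuffle A ?t" if "mset A + mset B = mset ?F" for A B
    by (rule deshuffle_forest_vec[OF exotic_rep mset_labels_split[OF that]])
  have \<Delta>B: "deshuffle (?v B) = unshuffle B ?t" if "mset A + mset B = mset ?F" for A B
    by (rule \<Delta>A[of B A], subst add.commute, rule that)
  have "tensor_assoc (tensor_map deshuffle id (unshuffle ?F ?t))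
      = unshuffle ?F (\<lambda>A C. tensor_assoc (tensor (deshuffle (?v A)) (?v C)))"
    by (simp only: lin_unshuffle[OF lin_tensor_map] lin_unshuffle[OF lin_tensor_assoc]
        tensor_map_tensor[OF lin_deshuffle lin_id(1)] id_apply)
  also have "\<dots> = unshuffle ?F (\<lambda>A C. tensor_assoc (tensor (unshuffle A ?t) (?v C)))"
    by (rule unshuffle_cong) (simp only: \<Delta>A)
  also have "\<dots> = unshuffle ?F (\<lambda>A C. unshuffle A (\<lambda>A1 A2. tensor (?v A1) (tensor (?v A2) (?v C))))"
    by (simp only: lin_unshuffle[OF bilin_lin(2)[OF bilin_tensor]] lin_unshuffle[OF lin_tensor_assoc] tensor_assoc_tensor)
  also have "\<dots> = unshuffle ?F (\<lambda>A C. unshuffle C (\<lambda>C1 C2. tensor (?v A) (tensor (?v C1) (?v C2))))"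
    by (rule unshuffle_assoc)
  also have "\<dots> = unshuffle ?F (\<lambda>A C. tensor (?v A) (unshuffle C ?t))"
    by (simp only: lin_unshuffle[OF bilin_lin(1)[OF bilin_tensor]])
  also have "\<dots> = unshuffle ?F (\<lambda>A C. tensor (?v A) (deshuffle (?v C)))"
    by (rule unshuffle_cong) (simp only: \<Delta>B)
  also have "\<dots> = tensor_map id deshuffle (unshuffle ?F ?t)"
    by (simp only: lin_unshuffle[OF lin_tensor_map]
        tensor_map_tensor[OF lin_id(1) lin_deshuffle] id_apply)
  finally show ?thesis unfolding \<Delta> .
qed

section \<open>The counit: the coefficient of the empty forest\<close>

definition coeff_empty :: "(exotic_forest \<Rightarrow>\<^sub>0 'k::field) \<Rightarrow> 'k" where
  "coeff_empty p = Poly_Mapping.lookup p empty_forest"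

lemma coeff_empty_add: "coeff_empty (x + y) = coeff_empty x + coeff_empty y"
  and coeff_empty_scale: "coeff_empty (scale c x) = c * coeff_empty x"
  and coeff_empty_0: "coeff_empty 0 = 0"
  by (simp_all add: coeff_empty_def lookup_add lookup_scale)

lemma coeff_empty_basis: "coeff_empty (basis \<pi>) = (if \<pi> = empty_forest then 1 else 0)"
  by (simp add: coeff_empty_def basis_def lookup_single when_def)

lemma coeff_empty_forest_vec: "coeff_empty (forest_vec F) = (if F = [] then 1 else 0)"
  by (cases "F = []")
    (simp_all add: forest_vec_def coeff_empty_0 coeff_empty_basis abs_eq_empty_iff)

lemma gl_product_unit: "gl_product (basis empty_forest) x = x" "gl_product x (basis empty_forest)
    = x"
proof -
  note gl = bilin_lin[OF bilin_gl_product]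
  have "gl_product (basis empty_forest) (basis \<pi>) = (basis \<pi> :: _ \<Rightarrow>\<^sub>0 'a)"
    "gl_product (basis \<pi>) (basis empty_forest) = (basis \<pi> :: _ \<Rightarrow>\<^sub>0 'a)" for \<pi>
    unfolding basis_empty_forest forest_vec_rep[of \<pi>] by (simp_all add: gl_product_forest_vec)
  then show "gl_product (basis empty_forest) x = x" "gl_product x (basis empty_forest) = x"
    using lin_eqI[OF gl(1) lin_id(2)] lin_eqI[OF gl(2) lin_id(2)] by blast+
qed

lemma coeff_empty_gl_product:
  "coeff_empty (gl_product x y) = coeff_empty x * (coeff_empty y :: 'k::field)"
proof -
  note gl = bilin_lin[OF bilin_gl_product]
  have basis: "coeff_empty (gl_product (basis \<pi>) (basis \<eta>))
      = coeff_empty (basis \<pi>) * (coeff_empty (basis \<eta>) :: 'k)" for \<pi> \<eta>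
  proof -
    obtain F G K where disj: "set (labels F) \<inter> set (labels G) = {}"
      and b: "basis \<pi> = (forest_vec F :: _ \<Rightarrow>\<^sub>0 'k)" "basis \<eta>
          = (forest_vec G :: _ \<Rightarrow>\<^sub>0 'k)" "basis \<eta> = (forest_vec K :: _ \<Rightarrow>\<^sub>0 'k)"
      by (rule obtain_disjoint_forests[of \<pi> \<eta> \<eta>])
    have "coeff_empty (gl_product (basis \<pi>) (basis \<eta>))
        = gl_sum F G (\<lambda>H. coeff_empty (forest_vec H) :: 'k)"
      unfolding b(1,2) gl_product_forest_vec[OF disj]
      by (rule gl_sum_hom[where L = coeff_empty]) (rule coeff_empty_add coeff_empty_0)+
    then show ?thesis
      by (simp add: coeff_empty_forest_vec gl_sum_eq_Nil b(1,2))
  qed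
  \<comment> \<open>Scalars are embedded into a free module of rank one, where \<open>bilin_eqI\<close> applies.\<close>
  let ?s = "\<lambda>c. scale c (basis () :: unit \<Rightarrow>\<^sub>0 'k)"
  have "?s (coeff_empty (gl_product x y)) = ?s (coeff_empty x * coeff_empty y)"
    by (rule bilin_eqI[of "\<lambda>x y. ?s (coeff_empty (gl_product x y))"])
      (simp_all add: bilin_def lin_iff coeff_empty_add coeff_empty_scale scale_add_left scale_scale
        lin_add[OF gl(1)] lin_add[OF gl(2)] lin_scale[OF gl(1)] lin_scale[OF gl(2)] algebra_simps basis)
  then have "Poly_Mapping.lookup (?s (coeff_empty (gl_product x y))) ()
      = Poly_Mapping.lookup (?s (coeff_empty x * coeff_empty y)) ()"
    by (rule arg_cong)
  then show ?thesis by (simp add: lookup_scale basis_def)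
qed

lemma comult_gl_product:
  "deshuffle (gl_product x y)
      = (tensor_mult gl_product (deshuffle x) (deshuffle y) :: _ \<Rightarrow>\<^sub>0 'k::field)"
  by (rule bilin_eqI[OF bilin_compose(1)[OF bilin_gl_product lin_deshuffle]
    bilin_compose(2)[OF bilin_tensor_mult lin_deshuffle lin_deshuffle] comult_gl_product_basis])

lemma coassoc_deshuffle:
  "tensor_assoc (tensor_map deshuffle id (deshuffle x))
      = (tensor_map id deshuffle (deshuffle x) :: _ \<Rightarrow>\<^sub>0 'k::field)"
  by (rule lin_eqI[OF lin_compose[OF lin_tensor_assoc lin_compose[OF lin_tensor_map lin_deshuffle]]
    lin_compose[OF lin_tensor_map lin_deshuffle] coassoc_deshuffle_basis])

lemma counit_deshuffle:
  "lin_ext (\<lambda>(a, b). scale (coeff_empty (basis a)) (basis b)) (deshuffle x)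
      = (x :: _ \<Rightarrow>\<^sub>0 'k::field)"
  "lin_ext (\<lambda>(a, b). scale (coeff_empty (basis b)) (basis a)) (deshuffle x) = x"
proof -
  let ?L = "lin_ext (\<lambda>(a, b). scale (coeff_empty (basis a)) (basis b)) :: _ \<Rightarrow> exotic_forest \<Rightarrow>\<^sub>0 'k"
    and ?R = "lin_ext
        (\<lambda>(a, b). scale (coeff_empty (basis b)) (basis a)) :: _ \<Rightarrow> exotic_forest \<Rightarrow>\<^sub>0 'k"
  have L: "?L (tensor x y) = scale (coeff_empty x) y" for x y
    by (rule bilin_eqI[OF bilin_compose(1)[OF bilin_tensor lin_lin_ext]])
      (simp_all add: bilin_def lin_iff coeff_empty_add coeff_empty_scale scale_add_left scale_add_right scale_scale mult.commute)
  have R: "?R (tensor x y) = scale (coeff_empty y) x" for x y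
    by (rule bilin_eqI[OF bilin_compose(1)[OF bilin_tensor lin_lin_ext]])
      (simp_all add: bilin_def lin_iff coeff_empty_add coeff_empty_scale scale_add_left scale_add_right scale_scale mult.commute)
  have "?L (deshuffle (basis \<pi>)) = basis \<pi>" for \<pi>
  proof -
    let ?F = "rep_exotic_forest \<pi>"
    have "?L (deshuffle (basis \<pi>))
        = unshuffle ?F (\<lambda>A B. scale (coeff_empty (forest_vec A)) (forest_vec B))"
      unfolding forest_vec_rep[of \<pi>] deshuffle_forest_vec_exotic[OF exotic_rep] lin_unshuffle[OF lin_lin_ext] L ..
    also have "\<dots> = unshuffle ?F (\<lambda>A B. if A = [] then forest_vec B else 0)"
      by (rule unshuffle_cong) (simp add: coeff_empty_forest_vec)
    finally show ?thesis by (simp only: unshuffle_Nil_left forest_vec_rep)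
  qed
  then show "?L (deshuffle x) = x"
    by (rule lin_eqI[OF lin_compose[OF lin_lin_ext lin_deshuffle] lin_id(2)])
  have "?R (deshuffle (basis \<pi>)) = basis \<pi>" for \<pi>
  proof -
    let ?F = "rep_exotic_forest \<pi>"
    have "?R (deshuffle (basis \<pi>))
        = unshuffle ?F (\<lambda>A B. scale (coeff_empty (forest_vec B)) (forest_vec A))"
      unfolding forest_vec_rep[of \<pi>] deshuffle_forest_vec_exotic[OF exotic_rep] lin_unshuffle[OF lin_lin_ext] R ..
    also have "\<dots> = unshuffle ?F (\<lambda>A B. if B = [] then forest_vec A else 0)"
      by (rule unshuffle_cong) (simp add: coeff_empty_forest_vec)
    finally show ?thesis by (simp only: unshuffle_Nil_right forest_vec_rep)
  qed
  then show "?R (deshuffle x) = x"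
    by (rule lin_eqI[OF lin_compose[OF lin_lin_ext lin_deshuffle] lin_id(2)])
qed

section \<open>Bialgebra structure, conilpotency and antipode\<close>

lemma bialgebra_exotic_forests:
  "bialgebra gl_product (basis empty_forest) deshuffle (coeff_empty :: (exotic_forest \<Rightarrow>\<^sub>0 'k::field) \<Rightarrow> 'k)"
proof (intro bialgebra.intro unital_algebra.intro counital_coalgebra.intro bialgebra_axioms.intro)
  have "vector_space ((*) :: 'k \<Rightarrow> 'k \<Rightarrow> 'k)"
    by (simp add: vector_space_def algebra_simps)
  then show "Vector_Spaces.linear scale (*) (coeff_empty :: _ \<Rightarrow> 'k)"
    unfolding Vector_Spaces.linear_iff
    by (simp add: vector_space_scale coeff_empty_add coeff_empty_scale)
  show "coeff_empty (basis empty_forest) = (1 :: 'k)"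
    by (simp add: coeff_empty_basis)
  show "deshuffle (basis empty_forest)
      = (tensor (basis empty_forest) (basis empty_forest) :: _ \<Rightarrow>\<^sub>0 'k)"
    unfolding basis_empty_forest by (simp add: deshuffle_forest_vec_exotic)
qed (simp_all only: bilin_lin(1,2)[OF bilin_gl_product] gl_product_assoc gl_product_unit lin_deshuffle
    coassoc_deshuffle counit_deshuffle comult_gl_product coeff_empty_gl_product)

text \<open>The parts with empty right factor give the leading tensor. In every other term the left
  factor has lost at least one tree.\<close>

lemma deshuffle_conilpotent:
  "\<exists>R. deshuffle (basis \<pi>) = tensor (basis \<pi>) (basis empty_forest) + (R :: _ \<Rightarrow>\<^sub>0 'k::field) \<and>
    (\<forall>(c, d) \<in> Poly_Mapping.keys R. length (rep_exotic_forest c) < length (rep_exotic_forest \<pi>))"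
proof (intro exI conjI)
  let ?v = "forest_vec :: _ \<Rightarrow> _ \<Rightarrow>\<^sub>0 'k"
  let ?F = "rep_exotic_forest \<pi>"
  let ?R = "unshuffle ?F (\<lambda>A B. if B = [] then 0 else tensor (?v A) (?v B))"
  have "deshuffle (basis \<pi>) = unshuffle ?F (\<lambda>A B. (if B = [] then tensor (?v A) (?v []) else 0) +
      (if B = [] then 0 else tensor (?v A) (?v B)))"
    unfolding forest_vec_rep[of \<pi>] deshuffle_forest_vec_exotic[OF exotic_rep]
        by (rule unshuffle_cong) simp
  then show "deshuffle (basis \<pi>) = tensor (basis \<pi>) (basis empty_forest) + ?R"
    by (simp only: unshuffle_add unshuffle_Nil_right forest_vec_rep[of \<pi>] basis_empty_forest)
  \<comment> \<open>Renumbering keeps the number of trees, so this size does not depend on the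
    representative.\<close>
  have len: "length (rep_exotic_forest (abs_exotic_forest A)) = length A" if "exotic A" for A
    using abs_relabelE[OF that exotic_rep abs_rep[symmetric]] by (metis length_map relabel_def)
  show "\<forall>(c, d) \<in> Poly_Mapping.keys ?R. length (rep_exotic_forest c) < length ?F"
  proof (rule unshuffle_closed)
    fix x y :: "exotic_forest \<times> exotic_forest \<Rightarrow>\<^sub>0 'k"
    assume "\<forall>(c, d) \<in> Poly_Mapping.keys x. length (rep_exotic_forest c) < length ?F"
      "\<forall>(c, d) \<in> Poly_Mapping.keys y. length (rep_exotic_forest c) < length ?F"
    then show "\<forall>(c, d) \<in> Poly_Mapping.keys (x + y). length (rep_exotic_forest c) < length ?F"
      using keys_add[of x y] by blast
  next
    fix A B assume AB: "mset A + mset B = mset ?F"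
    have "length A + length B = length ?F"
      using arg_cong[OF AB, of size] by simp
    then have "B \<noteq> [] \<Longrightarrow> length A < length ?F"
      by (cases B) simp_all
    then show "\<forall>(c, d) \<in> Poly_Mapping.keys (if B = [] then 0 else tensor (?v A) (?v B)).
        length (rep_exotic_forest c) < length ?F"
      by (auto simp: forest_vec_def bilin_0[OF bilin_tensor] len basis_def[of
          "(_, _)"] split: if_splits)
  qed
qed

theorem theorem4p4:
  shows "\<exists>(counit :: (exotic_forest \<Rightarrow>\<^sub>0 'k::field) \<Rightarrow> 'k) antipode.
    hopf_algebra gl_product (basis empty_forest) deshuffle counit antipode"
proof -
  interpret bialgebra gl_product "basis empty_forest" deshuffle
      "coeff_empty :: (exotic_forest \<Rightarrow>\<^sub>0 'k) \<Rightarrow> 'k"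
    by (rule bialgebra_exotic_forests)
  have "\<exists>antipode. hopf_algebra gl_product (basis empty_forest) deshuffle (coeff_empty :: _ \<Rightarrow> 'k) antipode"
    by (rule hopf_algebra_if_conilpotent[of empty_forest, OF refl _ deshuffle_conilpotent])
      (simp add: coeff_empty_basis)
  then show ?thesis by blast
qed

end
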